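(* There is a polynomial-time algorithm, with running time polynomial in $n$ and $K$, for the original problem below. On every instance it outputs a schedule whose total weighted completion time is at most $2(1+\sqrt2)$ times the optimum.
   Context: Original problem: a single machine must process jobs $\mathcal J=\{j_1,\dots,j_n\}$. Each job $j$ has a weight $w(j)\in\mathbb R_{\ge0}$ and is a finite set of operations. Each operation $o$ has a processing time $p(o)\in\mathbb R_{\ge0}$ and a family $f(o)\in\mathcal F=\{f_1,\dots,f_K\}$. Each family $f$ has a setup time $s(f)\in\mathbb R_{\ge0}$. A schedule is a permutation $\pi=(o_1,o_2,\dots)$ of all operations of all jobs. The completion time of $o_i$ is $C^\pi_{o_i}=\sum_{k=1}^i p(o_k)+\sum_{k=1}^i I(f(o_{k-1}),f(o_k))\,s(f(o_k))$, where $I(a,b)=0$ if $a=b$ and $1$ otherwise, and the first operation always incurs the setup of its family. The completion time of job $j$ is $C_j^\pi=\max_{o\in j}C^\pi_o$, and the objective is to minimize $\sum_j w(j)C^\pi_j$.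
   Formalization: The running time is polynomial in n and K plus a term linear in the number of operations, since a schedule lists them all and a job may have arbitrarily many; each operation belongs to one job, and time counts exact unit-cost operations on reals. *)

theory Defs
  imports Complex_Main "HOL-Combinatorics.Multiset_Permutations"
begin

section \<open>The scheduling problem\<close>

text \<open>
  Jobs, families and operations are numbered from 0, namely by the positions in the three
  lists of an instance.  An operation belongs to exactly one job; job \<open>j\<close> is the set
  \<open>ops_of_job I j\<close>.  Operations with equal data at different positions are different.
\<close>

record operation =
  op_job :: nat
  op_family :: nat
  op_time :: real

record problem =
  weights :: "real list"
  setups :: "real list"
  operations :: "operation list"

definition num_jobs :: "problem \<Rightarrow> nat" where
  "num_jobs I = length (weights I)"

definition num_families :: "problem \<Rightarrow> nat" where
  "num_families I = length (setups I)"

definition num_ops :: "problem \<Rightarrow> nat" where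
  "num_ops I = length (operations I)"

definition weight :: "problem \<Rightarrow> nat \<Rightarrow> real" where
  "weight I j = weights I ! j"

definition setup_time :: "problem \<Rightarrow> nat \<Rightarrow> real" where
  "setup_time I f = setups I ! f"

definition job_of :: "problem \<Rightarrow> nat \<Rightarrow> nat" where
  "job_of I x = op_job (operations I ! x)"

definition family :: "problem \<Rightarrow> nat \<Rightarrow> nat" where
  "family I x = op_family (operations I ! x)"

definition proc_time :: "problem \<Rightarrow> nat \<Rightarrow> real" where
  "proc_time I x = op_time (operations I ! x)"

definition ops_of_job :: "problem \<Rightarrow> nat \<Rightarrow> nat set" where
  "ops_of_job I j = {x. x < num_ops I \<and> job_of I x = j}"

definition valid_problem :: "problem \<Rightarrow> bool" where
  "valid_problem I \<longleftrightarrow>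
     (\<forall>j < num_jobs I. 0 \<le> weight I j) \<and>
     (\<forall>f < num_families I. 0 \<le> setup_time I f) \<and>
     (\<forall>x < num_ops I. job_of I x < num_jobs I \<and> family I x < num_families I
        \<and> 0 \<le> proc_time I x)"

definition schedules :: "problem \<Rightarrow> nat list set" where
  "schedules I = permutations_of_set {..<num_ops I}"

definition completion_at :: "problem \<Rightarrow> nat list \<Rightarrow> nat \<Rightarrow> real" where
  "completion_at I \<pi> i =
     (\<Sum>k\<le>i. proc_time I (\<pi> ! k)) +
     (\<Sum>k\<le>i. if k = 0 \<or> family I (\<pi> ! (k - 1)) \<noteq> family I (\<pi> ! k)
             then setup_time I (family I (\<pi> ! k)) else 0)"

definition op_completion :: "problem \<Rightarrow> nat list \<Rightarrow> nat \<Rightarrow> real" where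
  "op_completion I \<pi> x = completion_at I \<pi> (THE i. i < length \<pi> \<and> \<pi> ! i = x)"

text \<open>
  Completion times are nonnegative, so the inserted 0 does not change the maximum over a
  nonempty job; it makes a job without operations complete at time 0.
\<close>

definition job_completion :: "problem \<Rightarrow> nat list \<Rightarrow> nat \<Rightarrow> real" where
  "job_completion I \<pi> j = Max (insert 0 (op_completion I \<pi> ` ops_of_job I j))"

definition total_cost :: "problem \<Rightarrow> nat list \<Rightarrow> real" where
  "total_cost I \<pi> = (\<Sum>j < num_jobs I. weight I j * job_completion I \<pi> j)"

definition opt_cost :: "problem \<Rightarrow> real" where
  "opt_cost I = Min (total_cost I ` schedules I)"


section \<open>Algorithms and their running time\<close>

text \<open>
  Since the data of an instance are real numbers, algorithms are programs for a real random
  access machine, written in a while language.  Memory consists of named arrays of natural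
  numbers and named arrays of reals, indexed by natural numbers; a scalar variable is cell 0
  of an array.  Exact field operations and comparisons of reals have unit cost; there is no
  rounding and no conversion between reals and naturals.  Natural numbers can be added,
  subtracted (truncated at 0) and compared, at unit cost; they cannot be multiplied in one
  step, so that their bit length stays linear in the number of steps.
  The only real constants are integers.
\<close>

datatype nexp =
    NConst nat
  | NRead string nexp
  | NAdd nexp nexp
  | NSub nexp nexp

datatype rexp =
    RConst int
  | RRead string nexp
  | RAdd rexp rexp
  | RSub rexp rexp
  | RMul rexp rexp
  | RDiv rexp rexp

datatype bexp =
    NLess nexp nexp
  | RLess rexp rexp
  | BNot bexp
  | BAnd bexp bexp

datatype com =
    Skip
  | NWrite string nexp nexp
  | RWrite string nexp rexp
  | Seq com com
  | Cond bexp com com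
  | While bexp com

record state =
  nmem :: "string \<Rightarrow> nat \<Rightarrow> nat"
  rmem :: "string \<Rightarrow> nat \<Rightarrow> real"

fun nval :: "nexp \<Rightarrow> state \<Rightarrow> nat" where
  "nval (NConst c) s = c"
| "nval (NRead x i) s = nmem s x (nval i s)"
| "nval (NAdd a b) s = nval a s + nval b s"
| "nval (NSub a b) s = nval a s - nval b s"

fun rval :: "rexp \<Rightarrow> state \<Rightarrow> real" where
  "rval (RConst c) s = of_int c"
| "rval (RRead x i) s = rmem s x (nval i s)"
| "rval (RAdd a b) s = rval a s + rval b s"
| "rval (RSub a b) s = rval a s - rval b s"
| "rval (RMul a b) s = rval a s * rval b s"
| "rval (RDiv a b) s = rval a s / rval b s"

fun bval :: "bexp \<Rightarrow> state \<Rightarrow> bool" where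
  "bval (NLess a b) s \<longleftrightarrow> nval a s < nval b s"
| "bval (RLess a b) s \<longleftrightarrow> rval a s < rval b s"
| "bval (BNot a) s \<longleftrightarrow> \<not> bval a s"
| "bval (BAnd a b) s \<longleftrightarrow> bval a s \<and> bval b s"

fun ncost :: "nexp \<Rightarrow> nat" where
  "ncost (NConst c) = 1"
| "ncost (NRead x i) = ncost i + 1"
| "ncost (NAdd a b) = ncost a + ncost b + 1"
| "ncost (NSub a b) = ncost a + ncost b + 1"

fun rcost :: "rexp \<Rightarrow> nat" where
  "rcost (RConst c) = 1"
| "rcost (RRead x i) = ncost i + 1"
| "rcost (RAdd a b) = rcost a + rcost b + 1"
| "rcost (RSub a b) = rcost a + rcost b + 1"
| "rcost (RMul a b) = rcost a + rcost b + 1"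
| "rcost (RDiv a b) = rcost a + rcost b + 1"

fun bcost :: "bexp \<Rightarrow> nat" where
  "bcost (NLess a b) = ncost a + ncost b + 1"
| "bcost (RLess a b) = rcost a + rcost b + 1"
| "bcost (BNot a) = bcost a + 1"
| "bcost (BAnd a b) = bcost a + bcost b + 1"

definition nwrite :: "string \<Rightarrow> nat \<Rightarrow> nat \<Rightarrow> state \<Rightarrow> state" where
  "nwrite x i v s = s\<lparr>nmem := (nmem s)(x := (nmem s x)(i := v))\<rparr>"

definition rwrite :: "string \<Rightarrow> nat \<Rightarrow> real \<Rightarrow> state \<Rightarrow> state" where
  "rwrite x i v s = s\<lparr>rmem := (rmem s)(x := (rmem s x)(i := v))\<rparr>"

text \<open>
  \<open>exec c s t s'\<close>: started in state \<open>s\<close>, the program \<open>c\<close> halts after \<open>t\<close> steps in state \<open>s'\<close>.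
\<close>

inductive exec :: "com \<Rightarrow> state \<Rightarrow> nat \<Rightarrow> state \<Rightarrow> bool" where
  Skip: "exec Skip s 1 s"
| NWrite: "exec (NWrite x i e) s (ncost i + ncost e + 1) (nwrite x (nval i s) (nval e s) s)"
| RWrite: "exec (RWrite x i e) s (ncost i + rcost e + 1) (rwrite x (nval i s) (rval e s) s)"
| Seq: "exec c1 s t1 s1 \<Longrightarrow> exec c2 s1 t2 s2 \<Longrightarrow> exec (Seq c1 c2) s (t1 + t2) s2"
| CondTrue: "bval b s \<Longrightarrow> exec c1 s t s' \<Longrightarrow> exec (Cond b c1 c2) s (bcost b + t + 1) s'"
| CondFalse: "\<not> bval b s \<Longrightarrow> exec c2 s t s' \<Longrightarrow> exec (Cond b c1 c2) s (bcost b + t + 1) s'"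
| WhileFalse: "\<not> bval b s \<Longrightarrow> exec (While b c) s (bcost b + 1) s"
| WhileTrue: "bval b s \<Longrightarrow> exec c s t1 s1 \<Longrightarrow> exec (While b c) s1 t2 s2
    \<Longrightarrow> exec (While b c) s (bcost b + t1 + t2 + 1) s2"

inductive_cases SkipE: "exec Skip s t s'"
inductive_cases NWriteE: "exec (NWrite x i e) s t s'"
inductive_cases RWriteE: "exec (RWrite x i e) s t s'"
inductive_cases SeqE: "exec (Seq c1 c2) s t s'"
inductive_cases CondE: "exec (Cond b c1 c2) s t s'"
inductive_cases WhileE: "exec (While b c) s t s'"

lemma exec_deterministic:
  "exec c s t s' \<Longrightarrow> exec c s u s'' \<Longrightarrow> u = t \<and> s'' = s'"
proof (induction arbitrary: u s'' rule: exec.induct)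
  case (Skip s)
  then show ?case by (elim SkipE) simp
next
  case (NWrite x i e s)
  then show ?case by (elim NWriteE) simp
next
  case (RWrite x i e s)
  then show ?case by (elim RWriteE) simp
next
  case (Seq c1 s t1 s1 c2 t2 s2)
  from Seq.prems show ?case
  proof (rule SeqE)
    fix t1' s1' t2'
    assume u: "u = t1' + t2'" and 1: "exec c1 s t1' s1'" and 2: "exec c2 s1' t2' s''"
    have "t1' = t1 \<and> s1' = s1" using Seq.IH(1) 1 .
    moreover from this 2 have "t2' = t2 \<and> s'' = s2" by (intro Seq.IH(2)) simp
    ultimately show ?thesis using u by simp
  qed
next
  case (CondTrue b s c1 t s' c2)
  from CondTrue.prems show ?case
  proof (rule CondE)
    fix t'
    assume u: "u = Suc (bcost b + t')" and "exec c1 s t' s''"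
    from this(2) have "t' = t \<and> s'' = s'" by (rule CondTrue.IH)
    then show ?thesis using u by simp
  qed (use CondTrue.hyps in simp_all)
next
  case (CondFalse b s c2 t s' c1)
  from CondFalse.prems show ?case
  proof (rule CondE)
    fix t'
    assume u: "u = Suc (bcost b + t')" and "exec c2 s t' s''"
    from this(2) have "t' = t \<and> s'' = s'" by (rule CondFalse.IH)
    then show ?thesis using u by simp
  qed (use CondFalse.hyps in simp_all)
next
  case (WhileFalse b s c)
  from WhileFalse.prems show ?case by (rule WhileE) (use WhileFalse.hyps in auto)
next
  case (WhileTrue b s c t1 s1 t2 s2)
  from WhileTrue.prems show ?case
  proof (rule WhileE)
    fix t1' s1' t2'
    assume u: "u = Suc (bcost b + t1' + t2')" and 1: "exec c s t1' s1'"
      and 2: "exec (While b c) s1' t2' s''"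
    have "t1' = t1 \<and> s1' = s1" using WhileTrue.IH(1) 1 .
    moreover from this 2 have "t2' = t2 \<and> s'' = s2" by (intro WhileTrue.IH(2)) simp
    ultimately show ?thesis using u by simp
  qed (use WhileTrue.hyps(1) in simp_all)
qed

definition cells :: "'a::zero list \<Rightarrow> nat \<Rightarrow> 'a" where
  "cells xs i = (if i < length xs then xs ! i else 0)"

text \<open>
  All memory not mentioned here is initially 0.
\<close>

definition input_state :: "problem \<Rightarrow> state" where
  "input_state I =
     \<lparr>nmem = (\<lambda>_ _. 0)
        (''n'' := cells [num_jobs I],
         ''K'' := cells [num_families I],
         ''N'' := cells [num_ops I],
         ''job'' := cells (map op_job (operations I)),
         ''family'' := cells (map op_family (operations I))),
      rmem = (\<lambda>_ _. 0)
        (''w'' := cells (weights I),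
         ''s'' := cells (setups I),
         ''p'' := cells (map op_time (operations I)))\<rparr>"

definition output_schedule :: "problem \<Rightarrow> state \<Rightarrow> nat list" where
  "output_schedule I s = map (nmem s ''out'') [0..<num_ops I]"

text \<open>
  The running time is polynomial in the number of jobs and the number of families, up to a
  linear term for reading the operations and writing the schedule, which lists all of them.
  If no job has two operations of the same family, there are at most
  \<open>num_jobs I * num_families I\<close> operations, and the linear term is polynomial in these two, too.
\<close>

definition polynomial_time :: "com \<Rightarrow> bool" where
  "polynomial_time prog \<longleftrightarrow>
     (\<exists>a b d :: nat. \<forall>I. valid_problem I \<longrightarrow>
        (\<exists>t s. exec prog (input_state I) t s \<and>
           t \<le> a * (num_jobs I + num_families I + 1) ^ d + b * num_ops I))"

definition approximates :: "com \<Rightarrow> real \<Rightarrow> bool" where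
  "approximates prog \<alpha> \<longleftrightarrow>
     (\<forall>I. valid_problem I \<longrightarrow>
        (\<exists>t s. exec prog (input_state I) t s \<and>
           output_schedule I s \<in> schedules I \<and>
           total_cost I (output_schedule I s) \<le> \<alpha> * opt_cost I))"

end

theory Submission imports Defs begin

text \<open>
  A set of jobs costs at least the processing time and one setup for every family it uses, until its last
  job is complete; as a function of the set this is submodular.  For such a set function, a primal-dual
  procedure that places the jobs from last to first yields an order of the jobs in which the weighted sum of
  the costs of the prefixes is at most twice the optimum: as long as the set \<open>R\<close> of jobs is unplaced,
  reduce the weights by the largest possible multiple of a point \<open>a\<close> of the base polytope of \<open>R\<close>, and
  place a job whose weight becomes 0.  Each reduction contributes at least half of the square of the cost of
  \<open>R\<close> to every schedule, since \<open>\<Sum> a\<^sub>i a\<^sub>j\<close> over the pairs with \<open>i\<close> before \<open>j\<close> is at least half of the sum over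
  all pairs, and at most the square to the solution.

  Given the order, the operations of each family are split greedily into batches such that the
  processing time in a batch after its first operation is at most the setup time.  The setups of closed
  batches are paid by processing times, and the operations that an open batch processes ahead of the
  order are paid by its setup, so the completion time of a job is at most twice the cost of its
  prefix.  The two factors give 4, which is below \<open>2 (1 + \<surd>2)\<close>.
\<close>

section \<open>Running programs\<close>

fun nvars :: "com \<Rightarrow> string set" where
  "nvars Skip = {}"
| "nvars (NWrite x i e) = {x}"
| "nvars (RWrite x i e) = {}"
| "nvars (Seq c1 c2) = nvars c1 \<union> nvars c2"
| "nvars (Cond b c1 c2) = nvars c1 \<union> nvars c2"
| "nvars (While b c) = nvars c"

fun rvars :: "com \<Rightarrow> string set" where
  "rvars Skip = {}"
| "rvars (NWrite x i e) = {}"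
| "rvars (RWrite x i e) = {x}"
| "rvars (Seq c1 c2) = rvars c1 \<union> rvars c2"
| "rvars (Cond b c1 c2) = rvars c1 \<union> rvars c2"
| "rvars (While b c) = rvars c"

lemma nmem_nwrite [simp]:
  "nmem (nwrite x i v s) y = (if y = x then (nmem s x)(i := v) else nmem s y)"
  by (simp add: nwrite_def)

lemma rmem_nwrite [simp]: "rmem (nwrite x i v s) = rmem s"
  by (simp add: nwrite_def)

lemma nmem_rwrite [simp]: "nmem (rwrite x i v s) = nmem s"
  by (simp add: rwrite_def)

lemma rmem_rwrite [simp]:
  "rmem (rwrite x i v s) y = (if y = x then (rmem s x)(i := v) else rmem s y)"
  by (simp add: rwrite_def)

definition unchanged :: "com \<Rightarrow> state \<Rightarrow> state \<Rightarrow> bool" where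
  "unchanged c s s' \<longleftrightarrow>
     (\<forall>x. x \<notin> nvars c \<longrightarrow> nmem s' x = nmem s x) \<and> (\<forall>x. x \<notin> rvars c \<longrightarrow> rmem s' x = rmem s x)"

lemma unchanged_nmem: "unchanged c s s' \<Longrightarrow> x \<notin> nvars c \<Longrightarrow> nmem s' x = nmem s x"
  by (simp add: unchanged_def)

lemma exec_unchanged: "exec c s t s' \<Longrightarrow> unchanged c s s'"
  by (induction rule: exec.induct) (auto simp: unchanged_def)

text \<open>The frame condition is built in, so that a postcondition needs to mention only arrays
  that the program writes.\<close>

definition runs :: "com \<Rightarrow> state \<Rightarrow> nat \<Rightarrow> (state \<Rightarrow> bool) \<Rightarrow> bool" where
  "runs c s T Q \<longleftrightarrow> (\<exists>t s'. exec c s t s' \<and> t \<le> T \<and> unchanged c s s' \<and> Q s')"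

lemma runsI: "exec c s t s' \<Longrightarrow> t \<le> T \<Longrightarrow> Q s' \<Longrightarrow> runs c s T Q"
  by (auto simp: runs_def intro: exec_unchanged)

lemma runs_mono:
  "runs c s T Q \<Longrightarrow> T \<le> T' \<Longrightarrow> (\<And>s'. unchanged c s s' \<Longrightarrow> Q s' \<Longrightarrow> Q' s') \<Longrightarrow> runs c s T' Q'"
  unfolding runs_def by (meson le_trans)

lemma runs_Seq:
  assumes "runs c1 s T1 Q1"
    and "\<And>s'. unchanged c1 s s' \<Longrightarrow> Q1 s' \<Longrightarrow> runs c2 s' T2 Q"
  shows "runs (Seq c1 c2) s (T1 + T2) Q"
proof -
  obtain t1 s1 where 1: "exec c1 s t1 s1" "t1 \<le> T1" "unchanged c1 s s1" "Q1 s1"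
    using assms(1) by (auto simp: runs_def)
  obtain t2 s2 where 2: "exec c2 s1 t2 s2" "t2 \<le> T2" "Q s2"
    using assms(2)[OF 1(3,4)] by (auto simp: runs_def)
  show ?thesis
    by (rule runsI[OF exec.Seq[OF 1(1) 2(1)]]) (use 1 2 in simp_all)
qed

section \<open>Loop-free programs, evaluated symbolically\<close>

fun loop_free :: "com \<Rightarrow> bool" where
  "loop_free (Seq c1 c2) \<longleftrightarrow> loop_free c1 \<and> loop_free c2"
| "loop_free (Cond b c1 c2) \<longleftrightarrow> loop_free c1 \<and> loop_free c2"
| "loop_free (While b c) \<longleftrightarrow> False"
| "loop_free _ \<longleftrightarrow> True"

fun effect :: "com \<Rightarrow> state \<Rightarrow> state" where
  "effect Skip s = s"
| "effect (NWrite x i e) s = nwrite x (nval i s) (nval e s) s"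
| "effect (RWrite x i e) s = rwrite x (nval i s) (rval e s) s"
| "effect (Seq c1 c2) s = effect c2 (effect c1 s)"
| "effect (Cond b c1 c2) s = (if bval b s then effect c1 s else effect c2 s)"
| "effect (While b c) s = s"

text \<open>Adding the costs of both branches of \<open>Cond\<close> bounds either one without a
  maximum. The value at \<open>While\<close> is a dummy, as in \<open>effect\<close>:
  \<open>exec_effect\<close> covers loop-free programs only.\<close>

fun worst_cost :: "com \<Rightarrow> nat" where
  "worst_cost Skip = 1"
| "worst_cost (NWrite x i e) = ncost i + ncost e + 1"
| "worst_cost (RWrite x i e) = ncost i + rcost e + 1"
| "worst_cost (Seq c1 c2) = worst_cost c1 + worst_cost c2"
| "worst_cost (Cond b c1 c2) = bcost b + worst_cost c1 + worst_cost c2 + 1"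
| "worst_cost (While b c) = 0"

lemma exec_effect: "loop_free c \<Longrightarrow> \<exists>t \<le> worst_cost c. exec c s t (effect c s)"
proof (induction c arbitrary: s)
  case (Seq c1 c2)
  obtain t1 where 1: "t1 \<le> worst_cost c1" "exec c1 s t1 (effect c1 s)"
    using Seq by fastforce
  obtain t2 where 2: "t2 \<le> worst_cost c2" "exec c2 (effect c1 s) t2 (effect c2 (effect c1 s))"
    using Seq by fastforce
  show ?case using exec.Seq[OF 1(2) 2(2)] 1(1) 2(1)
    by (intro exI[of _ "t1 + t2"]) simp
next
  case (Cond b c1 c2)
  show ?case
  proof (cases "bval b s")
    case True
    obtain t where t: "t \<le> worst_cost c1" "exec c1 s t (effect c1 s)"
      using Cond by fastforce
    show ?thesis using exec.CondTrue[OF True t(2), of c2] t(1) True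
      by (intro exI[of _ "bcost b + t + 1"]) simp
  next
    case False
    obtain t where t: "t \<le> worst_cost c2" "exec c2 s t (effect c2 s)"
      using Cond by fastforce
    show ?thesis using exec.CondFalse[OF False t(2), of c1] t(1) False
      by (intro exI[of _ "bcost b + t + 1"]) simp
  qed
next
  case Skip
  show ?case using exec.Skip by (intro exI[of _ 1]) simp
next
  case (NWrite x i e)
  show ?case using exec.NWrite[of x i e s] by (intro exI[of _ "worst_cost (NWrite x i e)"]) simp
next
  case (RWrite x i e)
  show ?case using exec.RWrite[of x i e s] by (intro exI[of _ "worst_cost (RWrite x i e)"]) simp
qed simp

lemma runs_effect:
  "loop_free c \<Longrightarrow> worst_cost c \<le> T \<Longrightarrow> Q (effect c s) \<Longrightarrow> runs c s T Q"
  using exec_effect[of c s] by (meson le_trans runsI)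

section \<open>Counting loops\<close>

abbreviation "var x \<equiv> NRead x (NConst 0)"

definition For :: "string \<Rightarrow> nexp \<Rightarrow> com \<Rightarrow> com" where
  "For x e c = Seq (NWrite x (NConst 0) (NConst 0))
     (While (NLess (var x) e) (Seq c (NWrite x (NConst 0) (NAdd (var x) (NConst 1)))))"

lemma nvars_For [simp]: "nvars (For x e c) = insert x (nvars c)"
  by (auto simp: For_def)

lemma rvars_For [simp]: "rvars (For x e c) = rvars c"
  by (auto simp: For_def)

text \<open>The counter is advanced after the body, so an invariant that ignores the counter cell
  (\<open>indep\<close>) survives the increment. By \<open>bound\<close>, \<open>e\<close> has the
  same value \<open>n\<close> at every test, since each intermediate state differs from
  \<open>s\<close> only in arrays that the loop writes.\<close>

lemma runs_For:
  assumes x: "x \<notin> nvars c" and cost: "ncost e \<le> 6"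
    and bound: "\<And>s'. unchanged (For x e c) s s' \<Longrightarrow> nval e s' = n"
    and indep: "\<And>i v s'. Inv i s' \<Longrightarrow> Inv i (nwrite x 0 v s')"
    and init: "Inv 0 s"
    and body: "\<And>i s'. i < n \<Longrightarrow> unchanged (For x e c) s s' \<Longrightarrow> nmem s' x 0 = i \<Longrightarrow> Inv i s'
      \<Longrightarrow> runs c s' T (Inv (Suc i))"
  shows "runs (For x e c) s (Suc n * (T + 20)) (Inv n)"
proof -
  let ?W = "While (NLess (var x) e) (Seq c (NWrite x (NConst 0) (NAdd (var x) (NConst 1))))"
  \<comment> \<open>Besides the body, a round costs at most 9 for the test, 6 for the increment and
    1 for the loop itself, hence 16; the final failing test costs at most 10.\<close>
  have loop: "\<exists>t s''. exec ?W s' t s'' \<and> t \<le> (n - i) * (T + 16) + 10 \<and> Inv n s''"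
    if "i \<le> n" "unchanged (For x e c) s s'" "nmem s' x 0 = i" "Inv i s'" for i s'
    using that
  proof (induction "n - i" arbitrary: i s')
    case 0
    then have "i = n" and "\<not> bval (NLess (var x) e) s'" using bound[of s'] by auto
    then show ?case
      using exec.WhileFalse[of "NLess (var x) e" s'] cost 0
      by (intro exI[of _ "bcost (NLess (var x) e) + 1"] exI[of _ s']) auto
  next
    case (Suc d)
    then have i: "i < n" and b: "bval (NLess (var x) e) s'" using bound[of s'] by auto
    obtain t1 s1 where 1: "exec c s' t1 s1" "t1 \<le> T" "Inv (Suc i) s1" "unchanged c s' s1"
      using body[OF i Suc.prems(2-4)] unfolding runs_def by blast
    let ?s2 = "nwrite x 0 (Suc i) s1"
    have x1: "nmem s1 x 0 = i" using unchanged_nmem[OF 1(4) x] Suc.prems by simp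
    have "unchanged (For x e c) s ?s2"
      using Suc.prems(2) 1(4) by (auto simp: unchanged_def)
    moreover have "nmem ?s2 x 0 = Suc i" by simp
    moreover have "Inv (Suc i) ?s2" using indep 1(3) .
    ultimately obtain t2 s3 where 2: "exec ?W ?s2 t2 s3" "t2 \<le> (n - Suc i) * (T + 16) + 10" "Inv n s3"
      using Suc.hyps(1)[of "Suc i" ?s2] Suc.hyps(2) i by fastforce
    have "exec (NWrite x (NConst 0) (NAdd (var x) (NConst 1))) s1 6 ?s2"
      using exec.NWrite[of x "NConst 0" "NAdd (var x) (NConst 1)" s1] x1
      by (simp add: numeral_eq_Suc)
    from exec.WhileTrue[OF b exec.Seq[OF 1(1) this] 2(1)]
    have "exec ?W s' (bcost (NLess (var x) e) + (t1 + 6) + t2 + 1) s3" .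
    moreover have "bcost (NLess (var x) e) + (t1 + 6) + t2 + 1 \<le> (n - i) * (T + 16) + 10"
    proof -
      have "n - i = Suc (n - Suc i)" using i by simp
      then show ?thesis using 1(2) 2(2) cost by simp
    qed
    ultimately show ?case using 2(3) by blast
  qed
  let ?s0 = "nwrite x 0 0 s"
  have e0: "exec (NWrite x (NConst 0) (NConst 0)) s 3 ?s0"
    using exec.NWrite[of x "NConst 0" "NConst 0" s] by (simp add: numeral_eq_Suc)
  have "unchanged (For x e c) s ?s0" by (simp add: unchanged_def)
  then obtain t s' where t: "exec ?W ?s0 t s'" "t \<le> n * (T + 16) + 10" "Inv n s'"
    using loop[of 0 ?s0] indep[OF init] by auto
  show ?thesis
    unfolding For_def by (rule runsI[OF exec.Seq[OF e0 t(1)]]) (use t in \<open>simp_all add: algebra_simps\<close>)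
qed

section \<open>Bounds on completion times\<close>

definition load :: "problem \<Rightarrow> nat set \<Rightarrow> real" where
  "load I X = (\<Sum>x\<in>X. proc_time I x) + (\<Sum>f\<in>family I ` X. setup_time I f)"

definition ops_of_jobs :: "problem \<Rightarrow> nat set \<Rightarrow> nat set" where
  "ops_of_jobs I A = {x. x < num_ops I \<and> job_of I x \<in> A}"

lemma finite_ops_of_jobs [simp]: "finite (ops_of_jobs I A)"
  by (rule finite_subset[of _ "{..<num_ops I}"]) (auto simp: ops_of_jobs_def)

lemma ops_of_jobs_less: "ops_of_jobs I A \<subseteq> {..<num_ops I}"
  by (auto simp: ops_of_jobs_def)

lemma proc_time_nonneg: "valid_problem I \<Longrightarrow> x < num_ops I \<Longrightarrow> 0 \<le> proc_time I x"
  by (simp add: valid_problem_def)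

lemma setup_time_nonneg: "valid_problem I \<Longrightarrow> x < num_ops I \<Longrightarrow> 0 \<le> setup_time I (family I x)"
  by (simp add: valid_problem_def)

lemma load_mono:
  assumes "valid_problem I" "X \<subseteq> Y" "Y \<subseteq> {..<num_ops I}"
  shows "load I X \<le> load I Y"
  unfolding load_def using assms
  by (intro add_mono sum_mono2)
    (auto simp: finite_subset[of _ "{..<num_ops I}"] intro: proc_time_nonneg setup_time_nonneg)

lemma load_nonneg: "valid_problem I \<Longrightarrow> X \<subseteq> {..<num_ops I} \<Longrightarrow> 0 \<le> load I X"
  using load_mono[of I "{}" X] by (simp add: load_def)

lemma schedules_iff: "\<pi> \<in> schedules I \<longleftrightarrow> distinct \<pi> \<and> set \<pi> = {..<num_ops I}"
  by (auto simp: schedules_def permutations_of_set_def)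

lemma length_schedule: "\<pi> \<in> schedules I \<Longrightarrow> length \<pi> = num_ops I"
  using distinct_card[of \<pi>] by (auto simp: schedules_iff)

lemma op_completion_nth:
  assumes "\<pi> \<in> schedules I" "i < num_ops I"
  shows "op_completion I \<pi> (\<pi> ! i) = completion_at I \<pi> i"
proof -
  have "(THE i'. i' < length \<pi> \<and> \<pi> ! i' = \<pi> ! i) = i"
    using assms length_schedule[OF assms(1)]
    by (intro the_equality) (metis nth_eq_iff_index_eq schedules_iff)+
  then show ?thesis by (simp add: op_completion_def)
qed

lemma schedule_position:
  assumes "\<pi> \<in> schedules I" "x < num_ops I"
  obtains i where "i < num_ops I" "\<pi> ! i = x"
  using assms by (metis in_set_conv_nth length_schedule lessThan_iff schedules_iff)

definition switches :: "problem \<Rightarrow> nat list \<Rightarrow> nat \<Rightarrow> bool" where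
  "switches I \<pi> k \<longleftrightarrow> k = 0 \<or> family I (\<pi> ! (k - 1)) \<noteq> family I (\<pi> ! k)"

lemma completion_at_switches:
  "completion_at I \<pi> i = (\<Sum>k\<le>i. proc_time I (\<pi> ! k)) +
     (\<Sum>k | k \<le> i \<and> switches I \<pi> k. setup_time I (family I (\<pi> ! k)))"
proof -
  have "{k. k \<le> i \<and> switches I \<pi> k} = {k \<in> {..i}. switches I \<pi> k}" by auto
  then show ?thesis
    unfolding completion_at_def switches_def[symmetric] by (simp only: sum.inter_filter finite_atMost)
qed

lemma inj_on_schedule: "\<pi> \<in> schedules I \<Longrightarrow> S \<subseteq> {..<num_ops I} \<Longrightarrow> inj_on ((!) \<pi>) S"
  using length_schedule[of \<pi> I]
  by (intro inj_onI) (auto simp: schedules_iff nth_eq_iff_index_eq subset_iff)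

lemma nth_schedule_less: "\<pi> \<in> schedules I \<Longrightarrow> k < num_ops I \<Longrightarrow> \<pi> ! k < num_ops I"
  using nth_mem[of k \<pi>] by (auto simp: length_schedule schedules_iff)

text \<open>When the last operation of \<open>X\<close> is complete, all of \<open>X\<close> has
  been processed and each of its families has been set up at least once.\<close>

lemma load_le_completion:
  assumes I: "valid_problem I" and \<pi>: "\<pi> \<in> schedules I" and X: "X \<subseteq> {..<num_ops I}"
    and le: "\<And>x. x \<in> X \<Longrightarrow> op_completion I \<pi> x \<le> t" and t: "0 \<le> t"
  shows "load I X \<le> t"
proof (cases "X = {}")
  case True
  then show ?thesis using t by (simp add: load_def)
next
  case False
  define S where "S = {k. k < num_ops I \<and> \<pi> ! k \<in> X}"
  have fin: "finite S" by (simp add: S_def)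
  have XS: "X = (!) \<pi> ` S"
  proof
    show "X \<subseteq> (!) \<pi> ` S"
    proof
      fix x assume x: "x \<in> X"
      with X obtain k where "k < num_ops I" "\<pi> ! k = x" using schedule_position[OF \<pi>] by blast
      then show "x \<in> (!) \<pi> ` S" using x by (auto simp: S_def)
    qed
  qed (auto simp: S_def)
  define i where "i = Max S"
  have "S \<noteq> {}" using False XS by auto
  then have i: "i \<in> S" and S_le: "\<And>k. k \<in> S \<Longrightarrow> k \<le> i"
    using fin by (auto simp: i_def)
  have iN: "i < num_ops I" using i by (simp add: S_def)
  have "(\<Sum>x\<in>X. proc_time I x) = (\<Sum>k\<in>S. proc_time I (\<pi> ! k))"
    unfolding XS by (subst sum.reindex) (auto intro: inj_on_schedule[OF \<pi>] simp: S_def)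
  also have "\<dots> \<le> (\<Sum>k\<le>i. proc_time I (\<pi> ! k))"
    using S_le iN by (intro sum_mono2) (auto intro!: proc_time_nonneg[OF I] nth_schedule_less[OF \<pi>])
  finally have p: "(\<Sum>x\<in>X. proc_time I x) \<le> (\<Sum>k\<le>i. proc_time I (\<pi> ! k))" .
  have "family I ` X \<subseteq> (\<lambda>k. family I (\<pi> ! k)) ` {k. k \<le> i \<and> switches I \<pi> k}"
  proof
    fix f assume "f \<in> family I ` X"
    then obtain k where k: "k \<in> S" "family I (\<pi> ! k) = f" unfolding XS by auto
    \<comment> \<open>The first position of family \<open>f\<close> in the whole schedule is a
      switch: its predecessor, if there is one, has another family.\<close>
    define l where "l = (LEAST l. family I (\<pi> ! l) = f)"
    have l: "family I (\<pi> ! l) = f" unfolding l_def using k(2) by (rule LeastI)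
    have "l \<le> k" unfolding l_def using k(2) by (rule Least_le)
    then have "l \<le> i" using S_le[OF k(1)] by simp
    have "family I (\<pi> ! (l - 1)) \<noteq> f" if "l \<noteq> 0"
      using not_less_Least[of "l - 1" "\<lambda>l. family I (\<pi> ! l) = f"] that by (simp add: l_def)
    then have "switches I \<pi> l" using l by (auto simp: switches_def)
    then show "f \<in> (\<lambda>k. family I (\<pi> ! k)) ` {k. k \<le> i \<and> switches I \<pi> k}"
      using l \<open>l \<le> i\<close> by blast
  qed
  then have "(\<Sum>f\<in>family I ` X. setup_time I f)
      \<le> (\<Sum>f\<in>(\<lambda>k. family I (\<pi> ! k)) ` {k. k \<le> i \<and> switches I \<pi> k}. setup_time I f)"
    using iN by (intro sum_mono2) (auto intro!: setup_time_nonneg[OF I] nth_schedule_less[OF \<pi>])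
  also have "\<dots> \<le> (\<Sum>k | k \<le> i \<and> switches I \<pi> k. setup_time I (family I (\<pi> ! k)))"
    using iN by (intro order_trans[OF sum_image_le])
      (auto intro!: setup_time_nonneg[OF I] nth_schedule_less[OF \<pi>])
  finally have "load I X \<le> completion_at I \<pi> i"
    using p by (simp add: load_def completion_at_switches)
  also have "\<dots> = op_completion I \<pi> (\<pi> ! i)" using op_completion_nth[OF \<pi> iN] by simp
  also have "\<dots> \<le> t" using i by (intro le) (simp add: S_def)
  finally show ?thesis .
qed

section \<open>Completion times of jobs and the primal-dual lower bound\<close>

lemma finite_ops_of_job [simp]: "finite (ops_of_job I j)"
  by (rule finite_subset[of _ "{..<num_ops I}"]) (auto simp: ops_of_job_def)

lemma job_completion_nonneg: "0 \<le> job_completion I \<pi> j"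
  by (simp add: job_completion_def)

lemma op_le_job_completion: "x < num_ops I \<Longrightarrow> op_completion I \<pi> x \<le> job_completion I \<pi> (job_of I x)"
  unfolding job_completion_def by (intro Max_ge) (auto simp: ops_of_job_def)

lemma job_completion_le:
  "0 \<le> t \<Longrightarrow> (\<And>x. x < num_ops I \<Longrightarrow> job_of I x = j \<Longrightarrow> op_completion I \<pi> x \<le> t) \<Longrightarrow>
     job_completion I \<pi> j \<le> t"
  unfolding job_completion_def by (intro Max.boundedI) (auto simp: ops_of_job_def)

text \<open>In the language of submodular functions: \<open>a\<close> lies in the base polytope of
  \<open>\<lambda>A. load I (ops_of_jobs I A)\<close> restricted to \<open>R\<close>.\<close>

definition base :: "problem \<Rightarrow> nat set \<Rightarrow> (nat \<Rightarrow> real) \<Rightarrow> bool" where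
  "base I R a \<longleftrightarrow> (\<forall>j\<in>R. 0 \<le> a j) \<and> (\<forall>A\<subseteq>R. sum a A \<le> load I (ops_of_jobs I A)) \<and>
     sum a R = load I (ops_of_jobs I R)"

text \<open>The jobs of \<open>R\<close> that are complete when \<open>j\<close> is have load at
  most the completion time of \<open>j\<close>, and their load bounds their sum of \<open>a\<close>.
  Weighting by \<open>a j\<close> and summing over \<open>j\<close> leaves the products
  \<open>a i * a j\<close> over the pairs with \<open>i\<close> complete no later than
  \<open>j\<close>, which make up at least half of the square of \<open>sum a R\<close>.\<close>

lemma base_lower_bound:
  assumes I: "valid_problem I" and \<pi>: "\<pi> \<in> schedules I" and R: "finite R" and a: "base I R a"
  shows "(load I (ops_of_jobs I R))\<^sup>2 \<le> 2 * (\<Sum>j\<in>R. a j * job_completion I \<pi> j)"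
proof -
  let ?C = "job_completion I \<pi>"
  have nonneg: "0 \<le> a j" if "j \<in> R" for j using a that by (simp add: base_def)
  have C: "sum a {i\<in>R. ?C i \<le> ?C j} \<le> ?C j" for j
  proof -
    have "sum a {i\<in>R. ?C i \<le> ?C j} \<le> load I (ops_of_jobs I {i\<in>R. ?C i \<le> ?C j})"
      using a by (simp add: base_def)
    also have "\<dots> \<le> ?C j"
      by (rule load_le_completion[OF I \<pi> ops_of_jobs_less _ job_completion_nonneg])
        (auto simp: ops_of_jobs_def intro: order_trans[OF op_le_job_completion])
    finally show ?thesis .
  qed
  \<comment> \<open>Adding \<open>?P\<close> to its transpose covers every ordered pair, since of
    two jobs one is complete no later than the other; ties and the diagonal are covered
    twice.\<close>
  let ?P = "\<Sum>j\<in>R. \<Sum>i\<in>R. if ?C i \<le> ?C j then a i * a j else 0"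
  have "?P = (\<Sum>i\<in>R. \<Sum>j\<in>R. if ?C i \<le> ?C j then a i * a j else 0)"
    by (rule sum.swap)
  then have "2 * ?P = (\<Sum>j\<in>R. \<Sum>i\<in>R. (if ?C i \<le> ?C j then a i * a j else 0) +
      (if ?C j \<le> ?C i then a j * a i else 0))"
    by (simp add: sum.distrib)
  also have "\<dots> \<ge> (\<Sum>j\<in>R. \<Sum>i\<in>R. a i * a j)"
    using nonneg by (intro sum_mono) (auto simp: mult.commute)
  finally have 1: "(\<Sum>j\<in>R. \<Sum>i\<in>R. a i * a j) \<le> 2 * ?P" .
  have "(\<Sum>j\<in>R. \<Sum>i\<in>R. a i * a j) = (sum a R)\<^sup>2"
    by (simp add: power2_eq_square sum_product mult.commute)
  moreover have "?P = (\<Sum>j\<in>R. a j * sum a {i\<in>R. ?C i \<le> ?C j})"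
    by (rule sum.cong) (auto simp: sum_distrib_left sum.inter_filter[OF R] mult.commute intro!: sum.cong)
  moreover have "\<dots> \<le> (\<Sum>j\<in>R. a j * ?C j)"
    using nonneg C by (intro sum_mono mult_left_mono) auto
  ultimately show ?thesis using 1 a by (simp add: base_def)
qed

text \<open>The setup of each family is charged in full to one job of \<open>R\<close> that uses it.
  A subset \<open>A\<close> then pays only for families that it uses, hence at most its load, while
  \<open>R\<close> pays exactly once for each of its families. Families that \<open>R\<close> does
  not use are charged outside \<open>R\<close>.\<close>

lemma base_charge:
  assumes I: "valid_problem I" and R: "R \<subseteq> {..<num_jobs I}"
    and rep: "\<And>f. f < num_families I \<Longrightarrow>
      (if f \<in> family I ` ops_of_jobs I R then rep f \<in> R \<and> f \<in> family I ` ops_of_jobs I {rep f} else rep f \<notin> R)"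
    and a: "\<And>j. j \<in> R \<Longrightarrow> a j = (\<Sum>x\<in>ops_of_job I j. proc_time I x)
      + (\<Sum>f | f < num_families I \<and> rep f = j. setup_time I f)"
  shows "base I R a"
proof -
  have finR: "finite R" using R finite_subset by blast
  have s0: "0 \<le> setup_time I f" if "f < num_families I" for f
    using I that by (simp add: valid_problem_def)
  have fam: "family I ` ops_of_jobs I A \<subseteq> {..<num_families I}" for A
    using I by (auto simp: valid_problem_def ops_of_jobs_def)
  have sum_a: "sum a A = (\<Sum>x\<in>ops_of_jobs I A. proc_time I x)
      + (\<Sum>f | f < num_families I \<and> rep f \<in> A. setup_time I f)" if A: "A \<subseteq> R" for A
  proof -
    have finA: "finite A" using A finR finite_subset by blast
    have "ops_of_jobs I A = (\<Union>j\<in>A. ops_of_job I j)"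
      by (auto simp: ops_of_jobs_def ops_of_job_def)
    then have 1: "(\<Sum>x\<in>ops_of_jobs I A. proc_time I x) = (\<Sum>j\<in>A. \<Sum>x\<in>ops_of_job I j. proc_time I x)"
      using finA by (simp, subst sum.UNION_disjoint) (auto simp: ops_of_job_def)
    have "{f. f < num_families I \<and> rep f \<in> A} = (\<Union>j\<in>A. {f. f < num_families I \<and> rep f = j})"
      by auto
    then have 2: "(\<Sum>f | f < num_families I \<and> rep f \<in> A. setup_time I f)
        = (\<Sum>j\<in>A. \<Sum>f | f < num_families I \<and> rep f = j. setup_time I f)"
      using finA by (simp, subst sum.UNION_disjoint) auto
    show ?thesis unfolding 1 2 using A a by (auto simp: sum.distrib[symmetric] intro!: sum.cong)
  qed
  have "sum a A \<le> load I (ops_of_jobs I A)" if A: "A \<subseteq> R" for A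
  proof -
    have "{f. f < num_families I \<and> rep f \<in> A} \<subseteq> family I ` ops_of_jobs I A"
    proof
      fix f assume "f \<in> {f. f < num_families I \<and> rep f \<in> A}"
      then have "f \<in> family I ` ops_of_jobs I {rep f}" "rep f \<in> A"
        using rep[of f] A by (auto split: if_splits)
      then show "f \<in> family I ` ops_of_jobs I A" by (auto simp: ops_of_jobs_def)
    qed
    then show ?thesis unfolding sum_a[OF A] load_def
      using fam[of A] s0 by (intro add_left_mono sum_mono2) auto
  qed
  moreover have "{f. f < num_families I \<and> rep f \<in> R} = family I ` ops_of_jobs I R"
  proof (intro set_eqI iffI)
    fix f assume "f \<in> {f. f < num_families I \<and> rep f \<in> R}"
    then show "f \<in> family I ` ops_of_jobs I R" using rep[of f] by (metis mem_Collect_eq)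
  next
    fix f assume f: "f \<in> family I ` ops_of_jobs I R"
    then have "f < num_families I" using fam[of R] by blast
    then show "f \<in> {f. f < num_families I \<and> rep f \<in> R}" using rep[of f] f by simp
  qed
  then have "sum a R = load I (ops_of_jobs I R)" by (simp add: sum_a load_def)
  moreover have "0 \<le> a j" if "j \<in> R" for j
    using a[OF that] I s0
    by (auto intro!: add_nonneg_nonneg sum_nonneg proc_time_nonneg simp: ops_of_job_def)
  ultimately show ?thesis by (simp add: base_def)
qed

section \<open>Batches\<close>

text \<open>Distinct switches of a schedule that is sorted by batches lie in distinct batches, so each can be
  charged to the leading operation of its batch.\<close>

lemma completion_at_batched_le:
  fixes b :: "nat \<Rightarrow> nat"
  assumes I: "valid_problem I" and \<pi>: "\<pi> \<in> schedules I" and i: "i < num_ops I"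
    and sorted: "\<And>k l. k < l \<Longrightarrow> l < num_ops I \<Longrightarrow> b (\<pi> ! k) \<le> b (\<pi> ! l)"
    and fam: "\<And>x y. x < num_ops I \<Longrightarrow> y < num_ops I \<Longrightarrow> b x = b y \<Longrightarrow> family I x = family I y"
    and lead: "\<And>x. x < num_ops I \<Longrightarrow> \<exists>l\<in>Ld. b l = b x"
    and Ld: "Ld \<subseteq> {..<num_ops I}" and le: "b (\<pi> ! i) \<le> m"
  shows "completion_at I \<pi> i \<le> (\<Sum>x | x < num_ops I \<and> b x \<le> m. proc_time I x) +
    (\<Sum>l | l \<in> Ld \<and> b l \<le> m. setup_time I (family I l))"
proof -
  have less: "\<pi> ! k < num_ops I" if "k \<le> i" for k
    using that i nth_schedule_less[OF \<pi>] by simp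
  have bm: "b (\<pi> ! k) \<le> m" if "k \<le> i" for k
    using sorted[of k i] that i le by (cases "k = i") simp_all
  have "(\<Sum>k\<le>i. proc_time I (\<pi> ! k)) = sum (proc_time I) ((!) \<pi> ` {..i})"
    using i by (subst sum.reindex) (auto intro!: inj_on_schedule[OF \<pi>])
  also have "\<dots> \<le> (\<Sum>x | x < num_ops I \<and> b x \<le> m. proc_time I x)"
    using less bm by (intro sum_mono2) (auto intro: proc_time_nonneg[OF I])
  finally have p: "(\<Sum>k\<le>i. proc_time I (\<pi> ! k)) \<le> (\<Sum>x | x < num_ops I \<and> b x \<le> m. proc_time I x)" .
  define S where "S = {k. k \<le> i \<and> switches I \<pi> k}"
  define ld where "ld k = (SOME l. l \<in> Ld \<and> b l = b (\<pi> ! k))" for k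
  have ld: "ld k \<in> Ld" "b (ld k) = b (\<pi> ! k)" if "k \<le> i" for k
    using someI_ex[of "\<lambda>l. l \<in> Ld \<and> b l = b (\<pi> ! k)"] lead[OF less[OF that]]
    unfolding ld_def by blast+
  \<comment> \<open>The operation just before a switch at \<open>l\<close> has another family, hence
    another batch, and by \<open>sorted\<close> the number of that batch is smaller.\<close>
  have strict: "b (\<pi> ! k) < b (\<pi> ! l)" if "k < l" "l \<in> S" for k l
  proof -
    have "family I (\<pi> ! (l - 1)) \<noteq> family I (\<pi> ! l)" and l: "l \<le> i"
      using that by (auto simp: S_def switches_def)
    then have "b (\<pi> ! (l - 1)) \<noteq> b (\<pi> ! l)" using fam[of "\<pi> ! (l - 1)" "\<pi> ! l"] less by auto
    moreover have "b (\<pi> ! (l - 1)) \<le> b (\<pi> ! l)" using sorted[of "l - 1" l] that l i by simp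
    moreover have "b (\<pi> ! k) \<le> b (\<pi> ! (l - 1))"
      using sorted[of k "l - 1"] that l i by (cases "k = l - 1") auto
    ultimately show ?thesis by simp
  qed
  have inj: "inj_on ld S"
  proof (rule inj_onI)
    fix k l assume kl: "k \<in> S" "l \<in> S" "ld k = ld l"
    then have "b (\<pi> ! k) = b (\<pi> ! l)" using ld(2)[of k] ld(2)[of l] by (simp add: S_def)
    then show "k = l" using strict[of k l] strict[of l k] kl(1,2) by (metis less_irrefl nat_neq_iff)
  qed
  have "(\<Sum>k\<in>S. setup_time I (family I (\<pi> ! k))) = (\<Sum>k\<in>S. setup_time I (family I (ld k)))"
  proof (rule sum.cong)
    fix k assume "k \<in> S"
    then have k: "k \<le> i" by (simp add: S_def)
    show "setup_time I (family I (\<pi> ! k)) = setup_time I (family I (ld k))"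
      using fam[OF less[OF k], of "ld k"] ld[OF k] Ld by auto
  qed simp
  also have "\<dots> = (\<Sum>l\<in>ld ` S. setup_time I (family I l))"
    using inj by (simp add: sum.reindex)
  also have "\<dots> \<le> (\<Sum>l | l \<in> Ld \<and> b l \<le> m. setup_time I (family I l))"
    using Ld ld bm finite_subset[OF Ld]
    by (intro sum_mono2) (auto simp: S_def intro!: setup_time_nonneg[OF I])
  finally show ?thesis using p by (simp add: completion_at_switches S_def)
qed

text \<open>State of the batching procedure: the number of batches, the current batch of each family
  (0 if there is none), and the processing time in it, except for its first operation.\<close>

fun batch_step :: "problem \<Rightarrow> nat \<Rightarrow> nat \<times> (nat \<Rightarrow> nat) \<times> (nat \<Rightarrow> real) \<Rightarrow> nat \<times> (nat \<Rightarrow> nat) \<times> (nat \<Rightarrow> real)" where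
  "batch_step I x (m, cur, y) = (let f = family I x in
     if 0 < cur f \<and> y f + proc_time I x \<le> setup_time I f
     then (m, cur, y(f := y f + proc_time I x))
     else (Suc m, cur(f := Suc m), y(f := 0)))"

primrec batches :: "problem \<Rightarrow> (nat \<Rightarrow> nat) \<Rightarrow> nat \<Rightarrow> nat \<times> (nat \<Rightarrow> nat) \<times> (nat \<Rightarrow> real)" where
  "batches I q 0 = (0, \<lambda>_. 0, \<lambda>_. 0)"
| "batches I q (Suc i) = batch_step I (q i) (batches I q i)"

definition "batch_count I q i = fst (batches I q i)"
definition "current_batch I q i = fst (snd (batches I q i))"
definition "batch_fill I q i = snd (snd (batches I q i))"
text \<open>Read off after step \<open>i\<close>, when the current batch of the family is the one
  that \<open>q i\<close> has joined. Batch numbers start at 1, which leaves 0 for families without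
  a batch.\<close>

definition "batch_of I q i = current_batch I q (Suc i) (family I (q i))"
definition "extends I q i \<longleftrightarrow> 0 < current_batch I q i (family I (q i)) \<and>
  batch_fill I q i (family I (q i)) + proc_time I (q i) \<le> setup_time I (family I (q i))"

section \<open>Numbering of the batches and their opening operations\<close>

lemmas batch_defs = batch_count_def current_batch_def batch_fill_def

lemma batches_0:
  "batch_count I q 0 = 0" "current_batch I q 0 = (\<lambda>_. 0)" "batch_fill I q 0 = (\<lambda>_. 0)"
  by (simp_all add: batch_defs)

lemma batches_Suc:
  "batch_count I q (Suc i) = (if extends I q i then batch_count I q i else Suc (batch_count I q i))"
  "current_batch I q (Suc i) = (if extends I q i then current_batch I q i
     else (current_batch I q i)(family I (q i) := Suc (batch_count I q i)))"
  "batch_fill I q (Suc i) = (batch_fill I q i)(family I (q i) :=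
     if extends I q i then batch_fill I q i (family I (q i)) + proc_time I (q i) else 0)"
  by (cases "batches I q i"; simp add: batch_defs extends_def Let_def)+

lemma batch_of_eq:
  "batch_of I q i = (if extends I q i then current_batch I q i (family I (q i)) else Suc (batch_count I q i))"
  by (simp add: batch_of_def batches_Suc)

lemma batch_count_mono: "i \<le> j \<Longrightarrow> batch_count I q i \<le> batch_count I q j"
  by (rule lift_Suc_mono_le[of "batch_count I q"]) (simp_all add: batches_Suc)

lemma batch_count_le: "batch_count I q i \<le> i"
  by (induction i) (simp_all add: batches_0 batches_Suc)

lemma current_batch_le: "current_batch I q i f \<le> batch_count I q i"
proof (induction i)
  case (Suc i)
  then show ?case using le_SucI by (simp add: batches_Suc)
qed (simp add: batches_0)

lemma batch_of_le: "i < L \<Longrightarrow> batch_of I q i \<le> batch_count I q L"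
  unfolding batch_of_def using current_batch_le batch_count_mono[of "Suc i" L] le_trans by (metis Suc_leI)

lemma batch_of_pos: "0 < batch_of I q i"
  by (simp add: batch_of_eq extends_def)

lemma current_batch_pos_iff: "0 < current_batch I q i f \<longleftrightarrow> f \<in> family I ` q ` {..<i}"
proof (induction i)
  case (Suc i)
  then show ?case by (auto simp: batches_Suc lessThan_Suc extends_def)
qed (simp add: batches_0)

text \<open>The current batch of a family changes only when an operation that does not extend it
  opens a new one.\<close>

lemma current_batch_lead:
  "0 < current_batch I q i f \<Longrightarrow> \<exists>k<i. \<not> extends I q k \<and> family I (q k) = f \<and> batch_of I q k = current_batch I q i f"
proof (induction i)
  case (Suc i)
  show ?case
  proof (cases "extends I q i \<or> family I (q i) \<noteq> f")
    case True
    then have "current_batch I q (Suc i) f = current_batch I q i f" by (auto simp: batches_Suc)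
    then show ?thesis using Suc less_SucI by metis
  next
    case False
    then show ?thesis by (intro exI[of _ i]) (simp add: batches_Suc batch_of_eq)
  qed
qed (simp add: batches_0)

lemma batch_of_lead:
  obtains k where "k \<le> i" "\<not> extends I q k" "family I (q k) = family I (q i)" "batch_of I q k = batch_of I q i"
  using current_batch_lead[of I q "Suc i" "family I (q i)"] batch_of_pos[of I q i]
  unfolding batch_of_def by (metis less_Suc_eq_le)

text \<open>Batch numbers grow in the order of opening. Together with \<open>batch_of_le\<close>,
  the number \<open>batch_count I q L\<close> separates the batches opened by the first
  \<open>L\<close> operations from all later ones.\<close>

lemma lead_after:
  assumes "\<not> extends I q k" "L \<le> k"
  shows "batch_count I q L < batch_of I q k"
  using assms batch_count_mono[of L k I q] by (simp add: batch_of_eq)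

lemma lead_unique:
  assumes "\<not> extends I q k" "\<not> extends I q l" "batch_of I q k = batch_of I q l"
  shows "k = l"
proof -
  have "\<not> k < l" if "\<not> extends I q l" "batch_of I q k = batch_of I q l" for k l
    using lead_after[of I q l "Suc k"] batch_of_le[of k "Suc k" I q] that by auto
  from this[of k l] this[of l k] assms show ?thesis by simp
qed

lemma batch_family:
  assumes "batch_of I q i = batch_of I q j"
  shows "family I (q i) = family I (q j)"
proof -
  obtain k where "\<not> extends I q k" "family I (q k) = family I (q i)" "batch_of I q k = batch_of I q i"
    by (rule batch_of_lead)
  moreover obtain l where "\<not> extends I q l" "family I (q l) = family I (q j)" "batch_of I q l = batch_of I q j"
    by (rule batch_of_lead)
  ultimately show ?thesis using lead_unique[of I q k l] assms by simp
qed

section \<open>Processing times and setup times paying for each other\<close>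

lemma batch_fill_nonneg:
  assumes "valid_problem I" "q ` {..<i} \<subseteq> {..<num_ops I}"
  shows "0 \<le> batch_fill I q i f"
  using assms(2)
proof (induction i)
  case (Suc i)
  then show ?case using proc_time_nonneg[OF assms(1), of "q i"]
    by (auto simp: batches_Suc lessThan_Suc)
qed (simp add: batches_0)

text \<open>An extension is made only if the new fill is within the setup time, and a new batch
  starts with fill 0 because its first operation is not counted.\<close>

lemma batch_fill_le:
  assumes "valid_problem I" "q ` {..<i} \<subseteq> {..<num_ops I}" "f < num_families I"
  shows "batch_fill I q i f \<le> setup_time I f"
proof -
  have "0 \<le> setup_time I f" using assms by (simp add: valid_problem_def)
  then show ?thesis by (induction i) (auto simp: batches_0 batches_Suc extends_def)
qed

text \<open>A batch is closed only when the processing time after its first operation, together with the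
  first operation of the next batch of the same family, exceeds the setup time.\<close>

lemma setups_le:
  assumes I: "valid_problem I" and q: "q ` {..<i} \<subseteq> {..<num_ops I}"
  shows "(\<Sum>k | k < i \<and> \<not> extends I q k. setup_time I (family I (q k)))
      + (\<Sum>f\<in>family I ` q ` {..<i}. batch_fill I q i f)
    \<le> (\<Sum>k<i. proc_time I (q k)) + (\<Sum>f\<in>family I ` q ` {..<i}. setup_time I f)"
  using q
proof (induction i)
  case (Suc i)
  let ?F = "family I ` q ` {..<i}" and ?f = "family I (q i)"
  let ?y = "batch_fill I q i" and ?p = "proc_time I (q i)"
  have IH: "(\<Sum>k | k < i \<and> \<not> extends I q k. setup_time I (family I (q k))) + sum ?y ?F
    \<le> (\<Sum>k<i. proc_time I (q k)) + (\<Sum>f\<in>?F. setup_time I f)"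
    using Suc by (auto simp: lessThan_Suc)
  have p: "0 \<le> ?p" using Suc.prems proc_time_nonneg[OF I, of "q i"] by (simp add: lessThan_Suc)
  have F: "family I ` q ` {..<Suc i} = insert ?f ?F" by (simp add: lessThan_Suc)
  have upd: "sum (?y(?f := v)) ?F = sum ?y ?F - ?y ?f + v" if "?f \<in> ?F" for v
    using that by (simp add: sum.remove[of ?F ?f])
  have fin: "finite {k. k < i \<and> \<not> extends I q k}" by simp
  show ?case
  proof (cases "extends I q i")
    case True
    then have f: "?f \<in> ?F" using current_batch_pos_iff by (auto simp: extends_def)
    have "{k. k < Suc i \<and> \<not> extends I q k} = {k. k < i \<and> \<not> extends I q k}"
      using True less_Suc_eq by auto
    then show ?thesis using IH True f unfolding F
      by (simp add: batches_Suc upd insert_absorb del: fun_upd_apply)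
  next
    case False
    have "{k. k < Suc i \<and> \<not> extends I q k} = insert i {k. k < i \<and> \<not> extends I q k}"
      using False less_Suc_eq by auto
    then have Z: "(\<Sum>k | k < Suc i \<and> \<not> extends I q k. setup_time I (family I (q k)))
      = setup_time I ?f + (\<Sum>k | k < i \<and> \<not> extends I q k. setup_time I (family I (q k)))"
      by simp
    show ?thesis
    proof (cases "?f \<in> ?F")
      case True
      \<comment> \<open>A batch is replaced: the setup of the new one is below the fill that
        vanishes on the left plus the processing time \<open>?p\<close> gained on the right.\<close>
      then have "setup_time I ?f < ?y ?f + ?p"
        using False current_batch_pos_iff[of I q i ?f] by (auto simp: extends_def)
      then show ?thesis using IH False True unfolding F Z
        by (simp add: batches_Suc upd insert_absorb del: fun_upd_apply)
    next
      case nf: False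
      \<comment> \<open>The first batch of a family is paid by the new term in the last sum on the
        right.\<close>
      have "sum (?y(?f := 0)) ?F = sum ?y ?F" using nf by (intro sum.cong refl) (metis fun_upd_other)
      then show ?thesis using IH False nf p unfolding F Z
        by (simp add: batches_Suc fun_upd_same del: fun_upd_apply)
    qed
  qed
qed simp

text \<open>A batch opened at or after step \<open>L\<close> gets a number above
  \<open>batch_count I q L\<close>, so a current batch with an older number has been current since
  \<open>L\<close>.\<close>

lemma current_batch_unique:
  assumes "L \<le> i" "current_batch I q i f \<le> batch_count I q L"
  shows "current_batch I q i f = current_batch I q L f"
  using assms
proof (induction i rule: dec_induct)
  case (step i)
  show ?case
  proof (cases "extends I q i \<or> family I (q i) \<noteq> f")
    case True
    then have "current_batch I q (Suc i) f = current_batch I q i f" by (auto simp: batches_Suc)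
    then show ?thesis using step.IH step.prems by simp
  next
    case False
    then show ?thesis using batch_count_mono[OF step.hyps(1), of I q] step.prems
      by (simp add: batches_Suc)
  qed
qed simp

text \<open>This bounds the operations behind the prefix that join batches opened in the prefix. In
  each family only the batch current at \<open>L\<close> can still grow: to its present fill while
  it stays current, and to at most the setup time once it has been replaced and its fill is
  overwritten.\<close>

lemma late_extensions_le:
  assumes I: "valid_problem I" and q: "q ` {..<i} \<subseteq> {..<num_ops I}" and L: "L \<le> i"
  shows "(\<Sum>k | L \<le> k \<and> k < i \<and> batch_of I q k \<le> batch_count I q L. proc_time I (q k))
    \<le> (\<Sum>f\<in>family I ` q ` {..<L}. (if current_batch I q i f = current_batch I q L f
         then batch_fill I q i f else setup_time I f) - batch_fill I q L f)"
  using L q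
proof (induction i rule: dec_induct)
  case base
  have empty: "{k. L \<le> k \<and> k < L \<and> batch_of I q k \<le> batch_count I q L} = {}" by auto
  show ?case unfolding empty by simp
next
  case (step i)
  let ?F = "family I ` q ` {..<L}" and ?f = "family I (q i)" and ?m = "batch_count I q L"
  let ?t = "\<lambda>i f. (if current_batch I q i f = current_batch I q L f
         then batch_fill I q i f else setup_time I f) - batch_fill I q L f"
  let ?S = "\<lambda>i. {k. L \<le> k \<and> k < i \<and> batch_of I q k \<le> ?m}"
  have IH: "(\<Sum>k\<in>?S i. proc_time I (q k)) \<le> (\<Sum>f\<in>?F. ?t i f)"
    using step by (auto simp: lessThan_Suc)
  have qi: "q ` {..<i} \<subseteq> {..<num_ops I}" "q i < num_ops I"
    using step.prems by (auto simp: lessThan_Suc)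
  have fam: "f < num_families I" if "f \<in> ?F" for f
  proof -
    have "q ` {..<L} \<subseteq> {..<num_ops I}"
      using qi(1) step.hyps(1) by (meson image_mono lessThan_subset_iff subset_trans)
    then show ?thesis using that I by (fastforce simp: valid_problem_def)
  qed
  have other: "?t (Suc i) f = ?t i f" if "f \<noteq> ?f" for f
    using that by (auto simp: batches_Suc)
  have fin: "finite (?S i)" by simp
  show ?case
  proof (cases "batch_of I q i \<le> ?m")
    case True
    \<comment> \<open>An operation opening a batch at this point would get a number above
      \<open>?m\<close>.\<close>
    then have ext: "extends I q i" using lead_after[of I q i L] step.hyps(1) by auto
    then have b: "current_batch I q i ?f = batch_of I q i" "0 < current_batch I q i ?f"
      by (auto simp: batch_of_eq extends_def)
    have "current_batch I q i ?f = current_batch I q L ?f"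
      using current_batch_unique[OF step.hyps(1), of I q ?f] True b(1) by simp
    note cur = this
    have f: "?f \<in> ?F" using b(2) unfolding cur current_batch_pos_iff .
    have "?S (Suc i) = insert i (?S i)" using True step.hyps(1) by auto
    then have "(\<Sum>k\<in>?S (Suc i). proc_time I (q k)) = proc_time I (q i) + (\<Sum>k\<in>?S i. proc_time I (q k))"
      by simp
    also have "\<dots> \<le> proc_time I (q i) + (\<Sum>f\<in>?F. ?t i f)" using IH by simp
    also have "\<dots> = (\<Sum>f\<in>?F. ?t (Suc i) f)"
    proof -
      have "?t (Suc i) ?f = proc_time I (q i) + ?t i ?f" using ext cur by (simp add: batches_Suc)
      then show ?thesis using f other
        by (simp add: sum.remove[of ?F ?f])
    qed
    finally show ?thesis .
  next
    case False
    have "?S (Suc i) = ?S i" using False less_Suc_eq by auto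
    \<comment> \<open>If \<open>f\<close> is the family of \<open>q i\<close>, its current batch is
      now newer than the one at \<open>L\<close>, so its term has reached the upper bound given by
      the setup time.\<close>
    moreover have "?t i f \<le> ?t (Suc i) f" if f: "f \<in> ?F" for f
    proof (cases "f = ?f")
      case True
      have "current_batch I q (Suc i) ?f \<noteq> current_batch I q L ?f"
        using False current_batch_le[of I q L ?f] by (auto simp: batch_of_def)
      then show ?thesis using batch_fill_le[OF I qi(1) fam[OF f]] True by simp
    qed (simp add: other)
    then have "(\<Sum>f\<in>?F. ?t i f) \<le> (\<Sum>f\<in>?F. ?t (Suc i) f)" by (rule sum_mono)
    ultimately show ?thesis using IH by simp
  qed
qed

text \<open>The left side is the time for processing all batches opened by the first
  \<open>L\<close> operations. Late extensions add at most setup time minus fill per family, and by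
  \<open>setups_le\<close> the setups of these batches cost at most the load minus the same fills.
  The fills are nonnegative, so each of the two parts is at most the load.\<close>

lemma batched_prefix_le:
  assumes I: "valid_problem I" and q: "bij_betw q {..<num_ops I} {..<num_ops I}" and L: "L \<le> num_ops I"
  shows "(\<Sum>k | k < num_ops I \<and> batch_of I q k \<le> batch_count I q L. proc_time I (q k))
    + (\<Sum>k | k < L \<and> \<not> extends I q k. setup_time I (family I (q k))) \<le> 2 * load I (q ` {..<L})"
proof -
  let ?N = "num_ops I" and ?F = "family I ` q ` {..<L}" and ?m = "batch_count I q L"
  have qN: "q ` {..<?N} \<subseteq> {..<?N}" using q by (auto simp: bij_betw_def)
  then have qL: "q ` {..<L} \<subseteq> {..<?N}" using L by (meson image_mono lessThan_subset_iff subset_trans)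
  have fam: "f < num_families I" if f: "f \<in> ?F" for f
  proof -
    obtain k where "k \<in> {..<L}" "f = family I (q k)" using f by blast
    then show ?thesis using I qL by (auto simp: valid_problem_def)
  qed
  have split: "{k. k < ?N \<and> batch_of I q k \<le> ?m} = {..<L} \<union> {k. L \<le> k \<and> k < ?N \<and> batch_of I q k \<le> ?m}"
  proof (intro set_eqI)
    fix k show "k \<in> {k. k < ?N \<and> batch_of I q k \<le> ?m} \<longleftrightarrow>
      k \<in> {..<L} \<union> {k. L \<le> k \<and> k < ?N \<and> batch_of I q k \<le> ?m}"
      using L batch_of_le[of k L I q] by (cases "k < L") simp_all
  qed
  have "(\<Sum>k | k < ?N \<and> batch_of I q k \<le> ?m. proc_time I (q k)) = (\<Sum>k<L. proc_time I (q k))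
      + (\<Sum>k | L \<le> k \<and> k < ?N \<and> batch_of I q k \<le> ?m. proc_time I (q k))"
    unfolding split by (rule sum.union_disjoint) auto
  moreover have "(\<Sum>k | L \<le> k \<and> k < ?N \<and> batch_of I q k \<le> ?m. proc_time I (q k))
      \<le> (\<Sum>f\<in>?F. setup_time I f - batch_fill I q L f)"
  proof (rule order_trans[OF late_extensions_le[OF I qN L]], rule sum_mono)
    fix f assume "f \<in> ?F"
    then have "batch_fill I q ?N f \<le> setup_time I f" by (intro batch_fill_le[OF I qN] fam)
    then show "(if current_batch I q ?N f = current_batch I q L f then batch_fill I q ?N f
      else setup_time I f) - batch_fill I q L f \<le> setup_time I f - batch_fill I q L f" by simp
  qed
  ultimately have "(\<Sum>k | k < ?N \<and> batch_of I q k \<le> ?m. proc_time I (q k))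
    \<le> (\<Sum>k<L. proc_time I (q k)) + (\<Sum>f\<in>?F. setup_time I f) - (\<Sum>f\<in>?F. batch_fill I q L f)"
    unfolding sum_subtractf by linarith
  moreover note setups_le[OF I qL]
  moreover have "0 \<le> (\<Sum>f\<in>?F. batch_fill I q L f)"
    by (intro sum_nonneg batch_fill_nonneg[OF I qL])
  moreover have "inj_on q {..<L}" using q L by (meson bij_betw_def inj_on_subset lessThan_subset_iff)
  then have "load I (q ` {..<L}) = (\<Sum>k<L. proc_time I (q k)) + (\<Sum>f\<in>?F. setup_time I f)"
    by (simp add: load_def sum.reindex)
  ultimately show ?thesis by simp
qed

text \<open>The jobs placed no later than \<open>j\<close> form a prefix of \<open>q\<close>. Their
  operations lie in batches opened by this prefix, and a schedule sorted by batches processes those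
  batches before all others.\<close>

lemma job_completion_batched_le:
  fixes b pos :: "nat \<Rightarrow> nat"
  assumes I: "valid_problem I" and \<pi>: "\<pi> \<in> schedules I"
    and q: "bij_betw q {..<num_ops I} {..<num_ops I}"
    and q_sorted: "\<And>k l. k < l \<Longrightarrow> l < num_ops I \<Longrightarrow> pos (job_of I (q k)) \<le> pos (job_of I (q l))"
    and b: "\<And>k. k < num_ops I \<Longrightarrow> b (q k) = batch_of I q k"
    and \<pi>_sorted: "\<And>k l. k < l \<Longrightarrow> l < num_ops I \<Longrightarrow> b (\<pi> ! k) \<le> b (\<pi> ! l)"
  shows "job_completion I \<pi> j \<le> 2 * load I (ops_of_jobs I {i. pos i \<le> pos j})"
proof (rule job_completion_le)
  show "0 \<le> 2 * load I (ops_of_jobs I {i. pos i \<le> pos j})"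
    using load_nonneg[OF I ops_of_jobs_less] by simp
next
  let ?N = "num_ops I"
  fix x assume x: "x < ?N" "job_of I x = j"
  \<comment> \<open>\<open>L\<close> is the length of that prefix; the alternative \<open>?N\<close>
    applies if no operation belongs to a job behind \<open>j\<close>.\<close>
  define L where "L = (LEAST k. k = ?N \<or> pos j < pos (job_of I (q k)))"
  have L: "L = ?N \<or> pos j < pos (job_of I (q L))"
    unfolding L_def by (rule LeastI[of _ ?N]) simp
  have LN: "L \<le> ?N" unfolding L_def by (rule Least_le) simp
  have before: "pos (job_of I (q k)) \<le> pos j" if "k < L" for k
    using not_less_Least[of k "\<lambda>k. k = ?N \<or> pos j < pos (job_of I (q k))"] that
    unfolding L_def by (meson not_le)
  have after: "pos j < pos (job_of I (q k))" if "L \<le> k" "k < ?N" for k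
    using L q_sorted[of L k] that by (cases "L = k") auto
  have q_less: "q k < ?N" if "k < ?N" for k using q that by (auto simp: bij_betw_def)
  have q_surj: "\<exists>k<?N. q k = y" if "y < ?N" for y
    using q that unfolding bij_betw_def by (metis imageE lessThan_iff)
  have inj: "inj_on q {..<?N}" using q by (simp add: bij_betw_def)
  have prefix: "q ` {..<L} = ops_of_jobs I {i. pos i \<le> pos j}"
  proof (intro set_eqI iffI)
    fix y assume "y \<in> q ` {..<L}"
    then show "y \<in> ops_of_jobs I {i. pos i \<le> pos j}"
      using before q_less LN by (auto simp: ops_of_jobs_def)
  next
    fix y assume "y \<in> ops_of_jobs I {i. pos i \<le> pos j}"
    then have y: "y < ?N" "pos (job_of I y) \<le> pos j" by (auto simp: ops_of_jobs_def)
    then obtain k where k: "k < ?N" "q k = y" using q_surj by blast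
    then have "k < L" using after[of k] y(2) by (meson not_le)
    then show "y \<in> q ` {..<L}" using k by blast
  qed
  obtain i where i: "i < ?N" "\<pi> ! i = x" using schedule_position[OF \<pi> x(1)] .
  obtain k where k: "k < L" "q k = x"
    using x prefix by (metis (mono_tags, lifting) imageE lessThan_iff mem_Collect_eq ops_of_jobs_def order_refl)
  let ?m = "batch_count I q L" and ?Ld = "q ` {k. k < ?N \<and> \<not> extends I q k}"
  have bx: "b x \<le> ?m" using b[of k] batch_of_le[OF k(1), of I q] k LN by simp
  have "op_completion I \<pi> x = completion_at I \<pi> i"
    using op_completion_nth[OF \<pi> i(1)] i(2) by simp
  moreover have "completion_at I \<pi> i \<le> (\<Sum>x | x < ?N \<and> b x \<le> ?m. proc_time I x) +
    (\<Sum>l | l \<in> ?Ld \<and> b l \<le> ?m. setup_time I (family I l))"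
  proof (rule completion_at_batched_le[where b = b, OF I \<pi> i(1) \<pi>_sorted])
    fix x y assume "x < ?N" "y < ?N" "b x = b y"
    then show "family I x = family I y" using q_surj b batch_family[of I q] by metis
  next
    fix x assume "x < ?N"
    then obtain k where k: "k < ?N" "q k = x" using q_surj by blast
    obtain l where l: "l \<le> k" "\<not> extends I q l" "batch_of I q l = batch_of I q k"
      using batch_of_lead[where I=I and q=q and i=k] by blast
    then show "\<exists>l\<in>?Ld. b l = b x" using b[of l] b[of k] k by (intro bexI[of _ "q l"]) auto
  qed (use bx i q_less in auto)
  moreover have "(\<Sum>x | x < ?N \<and> b x \<le> ?m. proc_time I x)
      = (\<Sum>k | k < ?N \<and> batch_of I q k \<le> ?m. proc_time I (q k))"
  proof -
    have eq: "{x. x < ?N \<and> b x \<le> ?m} = q ` {k. k < ?N \<and> batch_of I q k \<le> ?m}"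
    proof (intro set_eqI iffI)
      fix y assume y: "y \<in> {x. x < ?N \<and> b x \<le> ?m}"
      then obtain k where "k < ?N" "q k = y" using q_surj by blast
      then show "y \<in> q ` {k. k < ?N \<and> batch_of I q k \<le> ?m}" using y b[of k] by auto
    qed (use q_less b in auto)
    have "inj_on q {k. k < ?N \<and> batch_of I q k \<le> ?m}" by (rule inj_on_subset[OF inj]) auto
    then show ?thesis unfolding eq by (simp add: sum.reindex)
  qed
  moreover have "(\<Sum>l | l \<in> ?Ld \<and> b l \<le> ?m. setup_time I (family I l))
      = (\<Sum>k | k < L \<and> \<not> extends I q k. setup_time I (family I (q k)))"
  proof -
    have "k < L" if "k < ?N" "\<not> extends I q k" "batch_of I q k \<le> ?m" for k
      using lead_after[OF that(2), of L] that(3) by (meson not_le)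
    then have "{l. l \<in> ?Ld \<and> b l \<le> ?m} \<subseteq> q ` {k. k < L \<and> \<not> extends I q k}"
      using b by auto
    moreover have "q k \<in> ?Ld \<and> b (q k) \<le> ?m" if "k < L" "\<not> extends I q k" for k
      using that b[of k] LN batch_of_le[of k L I q] by auto
    ultimately have eq: "{l. l \<in> ?Ld \<and> b l \<le> ?m} = q ` {k. k < L \<and> \<not> extends I q k}"
      by blast
    have "inj_on q {k. k < L \<and> \<not> extends I q k}" by (rule inj_on_subset[OF inj]) (use LN in auto)
    then show ?thesis unfolding eq by (simp add: sum.reindex)
  qed
  moreover have "(\<Sum>k | k < ?N \<and> batch_of I q k \<le> ?m. proc_time I (q k))
    + (\<Sum>k | k < L \<and> \<not> extends I q k. setup_time I (family I (q k))) \<le> 2 * load I (q ` {..<L})"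
    by (rule batched_prefix_le[OF I q LN])
  ultimately show "op_completion I \<pi> x \<le> 2 * load I (ops_of_jobs I {i. pos i \<le> pos j})"
    unfolding prefix by linarith
qed

section \<open>Ordering the jobs\<close>

text \<open>Position 0 marks a job that has not been placed yet.\<close>

definition unplaced :: "problem \<Rightarrow> (nat \<Rightarrow> nat) \<Rightarrow> nat set" where
  "unplaced I pos = {j. j < num_jobs I \<and> pos j = 0}"

text \<open>After \<open>r\<close> rounds the last \<open>r\<close> positions are taken; position 0
  puts the unplaced jobs before all placed ones. \<open>v\<close> holds the residual weights. On the
  left, placed jobs are charged at the load of their prefix, and weight already taken from unplaced
  jobs at the load of the unplaced set. On the right stands twice the cost of \<open>\<pi>\<close>
  without the share of the residual weights.\<close>

definition ordering_inv :: "problem \<Rightarrow> nat list \<Rightarrow> nat \<Rightarrow> (nat \<Rightarrow> nat) \<Rightarrow> (nat \<Rightarrow> real) \<Rightarrow> bool" where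
  "ordering_inv I \<pi> r pos v \<longleftrightarrow>
     (\<forall>j<num_jobs I. pos j = 0 \<or> num_jobs I - r < pos j \<and> pos j \<le> num_jobs I) \<and>
     card (unplaced I pos) = num_jobs I - r \<and>
     (\<forall>j\<in>unplaced I pos. 0 \<le> v j \<and> v j \<le> weight I j) \<and>
     (\<Sum>j | j < num_jobs I \<and> pos j \<noteq> 0. weight I j * load I (ops_of_jobs I {i. pos i \<le> pos j}))
       + (\<Sum>j\<in>unplaced I pos. weight I j - v j) * load I (ops_of_jobs I (unplaced I pos))
     \<le> 2 * (total_cost I \<pi> - (\<Sum>j\<in>unplaced I pos. v j * job_completion I \<pi> j))"

lemma finite_unplaced [simp]: "finite (unplaced I pos)"
  by (simp add: unplaced_def)

section \<open>The primal-dual invariant: start, end and one round\<close>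

lemma ordering_inv_init:
  assumes "valid_problem I" "\<And>j. j < num_jobs I \<Longrightarrow> pos j = 0" "\<And>j. j < num_jobs I \<Longrightarrow> v j = weight I j"
  shows "ordering_inv I \<pi> 0 pos v"
proof -
  have R: "unplaced I pos = {..<num_jobs I}" using assms(2) by (auto simp: unplaced_def)
  have placed: "{j. j < num_jobs I \<and> pos j \<noteq> 0} = {}" using assms(2) by auto
  have "(\<Sum>j<num_jobs I. v j * job_completion I \<pi> j) = total_cost I \<pi>"
    unfolding total_cost_def using assms(3) by (intro sum.cong) auto
  moreover have "(\<Sum>j<num_jobs I. weight I j - v j) = 0" using assms(3) by simp
  ultimately show ?thesis unfolding ordering_inv_def R placed
    using assms by (auto simp: valid_problem_def)
qed

lemma ordering_inv_final:
  assumes "ordering_inv I \<pi> (num_jobs I) pos v"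
  shows "(\<Sum>j<num_jobs I. weight I j * load I (ops_of_jobs I {i. pos i \<le> pos j})) \<le> 2 * total_cost I \<pi>"
proof -
  have R: "unplaced I pos = {}" using assms by (simp add: ordering_inv_def)
  then have placed: "{j. j < num_jobs I \<and> pos j \<noteq> 0} = {..<num_jobs I}" by (auto simp: unplaced_def)
  show ?thesis using assms unfolding ordering_inv_def R placed by simp
qed

text \<open>The hypothesis \<open>min\<close> says that \<open>k\<close> minimises
  \<open>v j / a j\<close>, cross-multiplied. Reducing by the multiple \<open>lam\<close> of
  \<open>a\<close> raises the left side by at most \<open>lam * g\<^sup>2\<close>, since
  \<open>a\<close> sums to the load \<open>g\<close>, and the right side by at least as much by
  \<open>base_lower_bound\<close>. Placing \<open>k\<close> costs nothing more: its weight has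
  already been charged at \<open>g\<close>, the load of its prefix.\<close>

lemma ordering_inv_step:
  assumes I: "valid_problem I" and \<pi>: "\<pi> \<in> schedules I" and r: "r < num_jobs I"
    and inv: "ordering_inv I \<pi> r pos v" and a: "base I (unplaced I pos) a"
    and k: "k \<in> unplaced I pos" and min: "\<And>j. j \<in> unplaced I pos \<Longrightarrow> v k * a j \<le> v j * a k"
    and v': "\<And>j. j \<in> unplaced I pos \<Longrightarrow> v' j = v j - v k / a k * a j"
  shows "ordering_inv I \<pi> (Suc r) (pos(k := num_jobs I - r)) v'"
proof -
  let ?n = "num_jobs I" and ?C = "job_completion I \<pi>"
  define R where "R = unplaced I pos"
  define pos' where "pos' = pos(k := ?n - r)"
  define lam where "lam = v k / a k"
  define g where "g = load I (ops_of_jobs I R)"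
  let ?R' = "R - {k}" and ?G = "\<lambda>pos j. load I (ops_of_jobs I {i. pos i \<le> pos j})"
  note a = a[folded R_def] and k = k[folded R_def] and min = min[folded R_def]
    and v' = v'[folded R_def lam_def]
  have finR: "finite R" by (simp add: R_def)
  have posR: "\<And>j. j < ?n \<Longrightarrow> pos j = 0 \<or> ?n - r < pos j \<and> pos j \<le> ?n"
    and cardR: "card R = ?n - r"
    and v: "\<And>j. j \<in> R \<Longrightarrow> 0 \<le> v j" "\<And>j. j \<in> R \<Longrightarrow> v j \<le> weight I j"
    and ineq: "(\<Sum>j | j < ?n \<and> pos j \<noteq> 0. weight I j * ?G pos j) + (\<Sum>j\<in>R. weight I j - v j) * g
      \<le> 2 * (total_cost I \<pi> - (\<Sum>j\<in>R. v j * ?C j))"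
    using inv unfolding ordering_inv_def R_def g_def by auto
  have kn: "k < ?n" "pos k = 0" using k by (auto simp: R_def unplaced_def)
  have a0: "0 \<le> a j" if "j \<in> R" for j using a that by (simp add: base_def)
  have lam0: "0 \<le> lam" unfolding lam_def using v(1)[OF k] a0[OF k] by simp
  have lam_le: "lam * a j \<le> v j" if j: "j \<in> R" for j
    using min[OF j] v(1)[OF j] a0[OF k] by (cases "a k = 0") (auto simp: lam_def field_simps)
  have R': "unplaced I pos' = ?R'" using r by (auto simp: unplaced_def pos'_def R_def)
  have nonneg_g: "0 \<le> g" unfolding g_def by (rule load_nonneg[OF I ops_of_jobs_less])
  \<comment> \<open>The residual weight of \<open>k\<close> can stay positive only if
    \<open>g = 0\<close>. For \<open>a k = 0\<close> the quotient \<open>lam\<close> is 0, and by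
    the choice of \<open>k\<close> either \<open>v k = 0\<close> or \<open>a\<close> vanishes on all
    of \<open>R\<close>.\<close>
  have last: "v' k * g = 0"
  proof (cases "a k = 0")
    case True
    have "v k = 0 \<or> (\<forall>j\<in>R. a j = 0)"
    proof (rule ccontr)
      assume "\<not> ?thesis"
      then obtain j where j: "j \<in> R" "a j \<noteq> 0" "v k \<noteq> 0" by auto
      then have "0 < v k * a j" using a0[OF j(1)] v(1)[OF k] by (simp add: less_le)
      then show False using min[OF j(1)] True by simp
    qed
    moreover have "g = sum a R" using a by (simp add: base_def g_def)
    ultimately show ?thesis using v'[OF k] True by auto
  next
    case False
    then show ?thesis using v'[OF k] by (simp add: lam_def)
  qed
  have G: "?G pos' j = ?G pos j" if "j < ?n" "pos j \<noteq> 0" for j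
  proof -
    have "j \<noteq> k" "?n - r < pos j" using that kn posR[OF that(1)] by auto
    then have "{i. pos' i \<le> pos' j} = {i. pos i \<le> pos j}" using kn by (auto simp: pos'_def)
    then show ?thesis by simp
  qed
  \<comment> \<open>Jobs placed earlier have positions above \<open>?n - r\<close>, so the prefix
    ending with \<open>k\<close> is the former unplaced set.\<close>
  have "ops_of_jobs I {i. pos' i \<le> pos' k} = ops_of_jobs I R"
  proof -
    have "pos' i \<le> pos' k \<longleftrightarrow> i \<in> R" if "i < ?n" for i
      using posR[OF that] that k by (auto simp: pos'_def R_def unplaced_def)
    then show ?thesis using I by (auto simp: ops_of_jobs_def valid_problem_def)
  qed
  then have Gk: "?G pos' k = g" by (simp add: g_def)
  have "{j. j < ?n \<and> pos' j \<noteq> 0} = insert k {j. j < ?n \<and> pos j \<noteq> 0}"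
    using kn r by (auto simp: pos'_def)
  then have placed: "(\<Sum>j | j < ?n \<and> pos' j \<noteq> 0. weight I j * ?G pos' j)
      = weight I k * g + (\<Sum>j | j < ?n \<and> pos j \<noteq> 0. weight I j * ?G pos j)"
    using kn G Gk by simp
  have g': "load I (ops_of_jobs I ?R') \<le> g"
    unfolding g_def by (rule load_mono[OF I _ ops_of_jobs_less]) (auto simp: ops_of_jobs_def)
  have w': "0 \<le> weight I j - v' j" if "j \<in> R" for j
    using v(2)[OF that] v'[OF that] mult_nonneg_nonneg[OF lam0 a0[OF that]] by simp
  \<comment> \<open>The smaller unplaced set has no larger load, so the removed weight may still be
    charged at \<open>g\<close>.\<close>
  have "(\<Sum>j\<in>?R'. weight I j - v' j) * load I (ops_of_jobs I ?R') \<le> (\<Sum>j\<in>?R'. weight I j - v' j) * g"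
    using g' w' by (intro mult_left_mono sum_nonneg) auto
  also have "\<dots> = ((\<Sum>j\<in>R. weight I j - v' j) - (weight I k - v' k)) * g"
    using finR k by (simp add: sum_diff1)
  also have "(\<Sum>j\<in>R. weight I j - v' j) = (\<Sum>j\<in>R. weight I j - v j) + lam * sum a R"
    by (simp add: v' sum_distrib_left sum.distrib[symmetric] algebra_simps)
  also have "sum a R = g" using a by (simp add: base_def g_def)
  finally have lhs: "weight I k * g + (\<Sum>j\<in>?R'. weight I j - v' j) * load I (ops_of_jobs I ?R')
      \<le> (\<Sum>j\<in>R. weight I j - v j) * g + lam * g\<^sup>2"
    using last by (auto simp: algebra_simps power2_eq_square)
  have "(\<Sum>j\<in>?R'. v' j * ?C j) = (\<Sum>j\<in>R. v' j * ?C j) - v' k * ?C k"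
    using finR k by (simp add: sum_diff1)
  also have "\<dots> \<le> (\<Sum>j\<in>R. v' j * ?C j)"
    using lam_le[OF k] v'[OF k] job_completion_nonneg[of I \<pi> k] by simp
  also have "\<dots> = (\<Sum>j\<in>R. v j * ?C j) - lam * (\<Sum>j\<in>R. a j * ?C j)"
    by (simp add: v' sum_distrib_left sum_subtractf[symmetric] algebra_simps)
  finally have "(\<Sum>j\<in>?R'. v' j * ?C j) \<le> (\<Sum>j\<in>R. v j * ?C j) - lam * (\<Sum>j\<in>R. a j * ?C j)" .
  moreover have "lam * g\<^sup>2 \<le> lam * (2 * (\<Sum>j\<in>R. a j * ?C j))"
    unfolding g_def using base_lower_bound[OF I \<pi> finR a] lam0 by (rule mult_left_mono)
  ultimately have "(\<Sum>j | j < ?n \<and> pos' j \<noteq> 0. weight I j * ?G pos' j)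
      + (\<Sum>j\<in>?R'. weight I j - v' j) * load I (ops_of_jobs I ?R')
    \<le> 2 * (total_cost I \<pi> - (\<Sum>j\<in>?R'. v' j * ?C j))"
    using lhs ineq unfolding placed by simp
  moreover have "card ?R' = ?n - Suc r" using cardR k finR by simp
  moreover have "pos' j = 0 \<or> ?n - Suc r < pos' j \<and> pos' j \<le> ?n" if "j < ?n" for j
    using posR[OF that] r by (auto simp: pos'_def)
  moreover have "0 \<le> v' j \<and> v' j \<le> weight I j" if "j \<in> ?R'" for j
    using that lam_le[of j] v'[of j] w'[of j] by auto
  ultimately show ?thesis unfolding ordering_inv_def R'[unfolded pos'_def] pos'_def by blast
qed

section \<open>Sorting\<close>

abbreviation count_body :: com where
  "count_body \<equiv> NWrite ''cnt'' (NAdd (NRead ''key'' (var ''i'')) (NConst 1))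
          (NAdd (NRead ''cnt'' (NAdd (NRead ''key'' (var ''i'')) (NConst 1))) (NConst 1))"

abbreviation add_body :: com where
  "add_body \<equiv> NWrite ''cnt'' (NAdd (var ''i'') (NConst 1))
          (NAdd (NRead ''cnt'' (NAdd (var ''i'') (NConst 1))) (NRead ''cnt'' (var ''i'')))"

abbreviation place_body :: com where
  "place_body \<equiv> Seq
          (NWrite ''out'' (NRead ''cnt'' (NRead ''key'' (var ''i''))) (var ''i''))
          (NWrite ''cnt'' (NRead ''key'' (var ''i''))
            (NAdd (NRead ''cnt'' (NRead ''key'' (var ''i''))) (NConst 1)))"

text \<open>\<open>cnt\<close> at \<open>k + 1\<close> first counts the keys equal to
  \<open>k\<close>; after the prefix sums, \<open>cnt\<close> at \<open>k\<close> is the next output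
  position for key \<open>k\<close>. The time is linear in \<open>N + M\<close>, as the time bound
  has only a linear term in the number of operations.\<close>

definition sort_prog :: com where
  "sort_prog =
    Seq (For ''i'' (NAdd (var ''M'') (NConst 1)) (NWrite ''cnt'' (var ''i'') (NConst 0)))
   (Seq (For ''i'' (var ''N'') count_body)
   (Seq (For ''i'' (var ''M'') add_body)
        (For ''i'' (var ''N'') place_body)))"

section \<open>Ranks in a stable sort\<close>

definition rank :: "nat \<Rightarrow> (nat \<Rightarrow> nat) \<Rightarrow> nat \<Rightarrow> nat" where
  "rank N key x = card {y. y < N \<and> (key y < key x \<or> key y = key x \<and> y < x)}"

text \<open>The first summand is where the block of this key begins, the second the number of equal
  keys placed before \<open>x\<close>; their sum is what \<open>cnt\<close> holds when
  \<open>x\<close> is placed.\<close>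

lemma rank_eq:
  assumes "x < N"
  shows "rank N key x = card {y. y < N \<and> key y < key x} + card {y. y < x \<and> key y = key x}"
proof -
  have "{y. y < N \<and> (key y < key x \<or> key y = key x \<and> y < x)}
      = {y. y < N \<and> key y < key x} \<union> {y. y < x \<and> key y = key x}"
    using assms by auto
  then show ?thesis unfolding rank_def by (simp add: card_Un_disjoint disjoint_iff)
qed

lemma rank_less_rank:
  assumes "x < N" "key x < key y \<or> key x = key y \<and> x < y"
  shows "rank N key x < rank N key y"
  unfolding rank_def using assms by (intro psubset_card_mono) auto

lemma rank_less: "x < N \<Longrightarrow> rank N key x < N"
proof -
  assume "x < N"
  then have "rank N key x < card {..<N}"
    unfolding rank_def by (intro psubset_card_mono) auto
  then show ?thesis by simp
qed

text \<open>\<open>rank N key\<close> is injective on \<open>{..<N}\<close> and maps it into itself,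
  so it is a permutation with inverse \<open>out\<close>; since it is strictly monotone in the key,
  \<open>out\<close> lists the keys in order.\<close>

lemma rank_inverse:
  assumes out: "\<And>x. x < N \<Longrightarrow> out (rank N key x) = x"
  shows "bij_betw out {..<N} {..<N}" and "k < l \<Longrightarrow> l < N \<Longrightarrow> key (out k) \<le> key (out l)"
proof -
  have "inj_on (rank N key) {..<N}" using out by (metis inj_onI lessThan_iff)
  moreover have "rank N key ` {..<N} \<subseteq> {..<N}" using rank_less by blast
  ultimately have surj: "rank N key ` {..<N} = {..<N}" by (intro endo_inj_surj) auto
  have ex: "\<exists>x<N. rank N key x = k \<and> out k = x" if "k < N" for k
  proof -
    have "k \<in> rank N key ` {..<N}" using that surj by simp
    then show ?thesis using out by auto
  qed
  show "bij_betw out {..<N} {..<N}"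
    by (rule bij_betw_byWitness[where f' = "rank N key"]) (use ex out rank_less in fastforce)+
  assume kl: "k < l" "l < N"
  then obtain x y where x: "x < N" "rank N key x = k" "out k = x" and y: "y < N" "rank N key y = l" "out l = y"
    using ex[of k] ex[of l] by auto
  have "\<not> key y < key x" using rank_less_rank[OF y(1), of key x] x y kl by auto
  then show "key (out k) \<le> key (out l)" using x y by simp
qed

lemma card_less_Suc: "card {y. y < Suc i \<and> P y} = card {y. y < i \<and> P y} + (if P i then 1 else 0)"
proof -
  have "{y. y < Suc i \<and> P y} = (if P i then insert i {y. y < i \<and> P y} else {y. y < i \<and> P y})"
    by (auto simp: less_Suc_eq)
  then show ?thesis by simp
qed

lemma runs_sort:
  assumes N: "nmem s ''N'' 0 = N" and M: "nmem s ''M'' 0 = M"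
    and key: "\<And>x. x < N \<Longrightarrow> nmem s ''key'' x < M"
  shows "runs sort_prog s (100 * (N + M + 3)) (\<lambda>s'. bij_betw (nmem s' ''out'') {..<N} {..<N} \<and>
    (\<forall>k l. k < l \<longrightarrow> l < N \<longrightarrow> nmem s ''key'' (nmem s' ''out'' k) \<le> nmem s ''key'' (nmem s' ''out'' l)))"
proof -
  let ?key = "nmem s ''key''"
  let ?in = "\<lambda>s'. nmem s' ''N'' 0 = N \<and> nmem s' ''M'' 0 = M \<and> nmem s' ''key'' = ?key"
  let ?L1 = "For ''i'' (NAdd (var ''M'') (NConst 1)) (NWrite ''cnt'' (var ''i'') (NConst 0))"
  let ?L2 = "For ''i'' (var ''N'') count_body" and ?L3 = "For ''i'' (var ''M'') add_body"
  let ?L4 = "For ''i'' (var ''N'') place_body"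
  let ?I1 = "\<lambda>i s'. \<forall>k<i. nmem s' ''cnt'' k = 0"
  let ?I2 = "\<lambda>i s'. \<forall>k<Suc M. nmem s' ''cnt'' k = card {x. x < i \<and> Suc (?key x) = k}"
  \<comment> \<open>The prefix sums are formed in place: entries up to \<open>i\<close> are
    cumulative, the others are still plain counts.\<close>
  let ?I3 = "\<lambda>i s'. \<forall>k<Suc M. nmem s' ''cnt'' k =
    (if k \<le> i then card {x. x < N \<and> ?key x < k} else card {x. x < N \<and> Suc (?key x) = k})"
  let ?I4 = "\<lambda>i s'. (\<forall>k<M. nmem s' ''cnt'' k =
      card {x. x < N \<and> ?key x < k} + card {x. x < i \<and> ?key x = k}) \<and>
    (\<forall>x<i. nmem s' ''out'' (rank N ?key x) = x)"
  have 1: "runs ?L1 s (Suc (Suc M) * (20 + 20)) (?I1 (Suc M))"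
  proof (rule runs_For[where Inv = ?I1])
    fix i and s' :: state
    assume "nmem s' ''i'' 0 = i" "?I1 i s'"
    then show "runs (NWrite ''cnt'' (var ''i'') (NConst 0)) s' 20 (?I1 (Suc i))"
      by (intro runs_effect) (auto simp: less_Suc_eq)
  qed (auto simp: unchanged_def M)
  have 2: "runs ?L2 s1 (Suc N * (20 + 20)) (?I2 N)" if s1: "?in s1" "?I1 (Suc M) s1" for s1 :: state
  proof (rule runs_For[where Inv = ?I2])
    fix i and s' :: state
    assume i: "i < N" "nmem s' ''i'' 0 = i" and "unchanged ?L2 s1 s'" and inv: "?I2 i s'"
    then have "nmem s' ''key'' = ?key" using s1 by (simp add: unchanged_def)
    then show "runs count_body s' 20 (?I2 (Suc i))"
      using inv i key[OF i(1)] by (intro runs_effect) (simp_all add: card_less_Suc)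
  qed (use s1 in \<open>auto simp: unchanged_def\<close>)
  have 3: "runs ?L3 s2 (Suc M * (20 + 20)) (?I3 M)" if s2: "?in s2" "?I2 N s2" for s2 :: state
  proof (rule runs_For[where Inv = ?I3])
    fix i and s' :: state
    assume i: "i < M" "nmem s' ''i'' 0 = i" and inv: "?I3 i s'"
    have "{x. x < N \<and> ?key x < Suc i} = {x. x < N \<and> ?key x < i} \<union> {x. x < N \<and> ?key x = i}"
      by auto
    then have "card {x. x < N \<and> ?key x < Suc i} = card {x. x < N \<and> ?key x = i} + card {x. x < N \<and> ?key x < i}"
      by (simp add: card_Un_disjoint disjoint_iff)
    then show "runs add_body s' 20 (?I3 (Suc i))"
      using i inv by (intro runs_effect) (auto simp: le_Suc_eq)
  qed (use s2 in \<open>auto simp: unchanged_def\<close>)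
  have 4: "runs ?L4 s3 (Suc N * (30 + 20)) (?I4 N)" if s3: "?in s3" "?I3 M s3" for s3 :: state
  proof (rule runs_For[where Inv = ?I4])
    fix i and s' :: state
    assume i: "i < N" "nmem s' ''i'' 0 = i" and inv: "?I4 i s'" and "unchanged ?L4 s3 s'"
    then have k: "nmem s' ''key'' = ?key" using s3 by (simp add: unchanged_def)
    have "nmem s' ''cnt'' (?key i) = rank N ?key i"
      using inv i key[OF i(1)] by (simp add: rank_eq)
    moreover have "rank N ?key x \<noteq> rank N ?key i" if "x < i" for x
      using rank_less_rank[of x N ?key i] rank_less_rank[of i N ?key x] that i(1)
      by (cases "?key x" "?key i" rule: linorder_cases) simp_all
    ultimately show "runs place_body s' 30 (?I4 (Suc i))"
      using inv i key[OF i(1)] k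
      by (intro runs_effect) (auto simp: card_less_Suc All_less_Suc)
  qed (use s3 in \<open>auto simp: unchanged_def\<close>)
  have in0: "?in s" using N M by simp
  have in1: "?in s'" if "unchanged ?L1 r s'" "?in r" for r s' using that by (simp add: unchanged_def)
  have in2: "?in s'" if "unchanged ?L2 r s'" "?in r" for r s' using that by (simp add: unchanged_def)
  have in3: "?in s'" if "unchanged ?L3 r s'" "?in r" for r s' using that by (simp add: unchanged_def)
  have "runs sort_prog s (Suc (Suc M) * (20 + 20) + (Suc N * (20 + 20) + (Suc M * (20 + 20) + Suc N * (30 + 20)))) (?I4 N)"
    unfolding sort_prog_def
    by (rule runs_Seq[OF 1] runs_Seq[OF 2] runs_Seq[OF 3] 4 in0 | erule in1 in2 in3 | assumption)+
  then show ?thesis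
  proof (rule runs_mono)
    fix s'
    assume "?I4 N s'"
    then show "bij_betw (nmem s' ''out'') {..<N} {..<N} \<and>
      (\<forall>k l. k < l \<longrightarrow> l < N \<longrightarrow> ?key (nmem s' ''out'' k) \<le> ?key (nmem s' ''out'' l))"
      using rank_inverse[of N "nmem s' ''out''" ?key] by blast
  qed simp
qed

section \<open>The algorithm\<close>

text \<open>The weights are left out because \<open>w\<close> is overwritten by the residual
  weights.\<close>

definition has_input :: "problem \<Rightarrow> state \<Rightarrow> bool" where
  "has_input I s \<longleftrightarrow> nmem s ''n'' 0 = num_jobs I \<and> nmem s ''K'' 0 = num_families I \<and>
     nmem s ''N'' 0 = num_ops I \<and>
     (\<forall>x<num_ops I. nmem s ''job'' x = job_of I x \<and> nmem s ''family'' x = family I x \<and>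
        rmem s ''p'' x = proc_time I x) \<and>
     (\<forall>f<num_families I. rmem s ''s'' f = setup_time I f)"

lemma has_input_unchanged:
  assumes "unchanged c s s'" "has_input I s"
    and "nvars c \<inter> {''n'', ''K'', ''N'', ''job'', ''family''} = {}" "rvars c \<inter> {''p'', ''s''} = {}"
  shows "has_input I s'"
proof -
  have "nmem s' x = nmem s x" if "x \<in> {''n'', ''K'', ''N'', ''job'', ''family''}" for x
    using assms that by (auto simp: unchanged_def)
  moreover have "rmem s' x = rmem s x" if "x \<in> {''p'', ''s''}" for x
    using assms that by (auto simp: unchanged_def)
  ultimately show ?thesis using assms(2) by (simp add: has_input_def)
qed

text \<open>\<open>use\<close> holds the incidence matrix of jobs and families by rows; \<open>row\<close> holds the offset of each row.\<close>

abbreviation row_body :: com where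
  "row_body \<equiv> NWrite ''row'' (NAdd (var ''j'') (NConst 1))
          (NAdd (NRead ''row'' (var ''j'')) (var ''K''))"

abbreviation use_body :: com where
  "use_body \<equiv> Seq
          (NWrite ''use'' (NAdd (NRead ''row'' (NRead ''job'' (var ''i''))) (NRead ''family'' (var ''i''))) (NConst 1))
          (RWrite ''P'' (NRead ''job'' (var ''i''))
            (RAdd (RRead ''P'' (NRead ''job'' (var ''i''))) (RRead ''p'' (var ''i''))))"

section \<open>Incidence of jobs and families, and total processing times of jobs\<close>

definition prepare_prog :: com where
  "prepare_prog =
    Seq (For ''j'' (var ''n'') row_body)
        (For ''i'' (var ''N'') use_body)"

text \<open>A summary computed once, in time linear in the operations. The rounds of the ordering
  read only this summary, so their time depends on the numbers of jobs and families alone.\<close>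

definition prepared :: "problem \<Rightarrow> state \<Rightarrow> bool" where
  "prepared I s \<longleftrightarrow>
     (\<forall>j<num_jobs I. \<forall>f<num_families I.
        0 < nmem s ''use'' (nmem s ''row'' j + f) \<longleftrightarrow> f \<in> family I ` ops_of_jobs I {j}) \<and>
     (\<forall>j<num_jobs I. rmem s ''P'' j = (\<Sum>x\<in>ops_of_job I j. proc_time I x))"

lemma prepared_unchanged:
  assumes "unchanged c s s'" "prepared I s" "nvars c \<inter> {''use'', ''row''} = {}" "rvars c \<inter> {''P''} = {}"
  shows "prepared I s'"
proof -
  have "nmem s' x = nmem s x" if "x \<in> {''use'', ''row''}" for x
    using assms that by (auto simp: unchanged_def)
  moreover have "rmem s' ''P'' = rmem s ''P''"
    using assms by (auto simp: unchanged_def)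
  ultimately show ?thesis using assms(2) by (simp add: prepared_def)
qed

lemma row_index_eq:
  fixes f g K :: nat
  assumes "f < K" "g < K"
  shows "i * K + f = j * K + g \<longleftrightarrow> i = j \<and> f = g"
proof
  assume "i * K + f = j * K + g"
  then have "(i * K + f) div K = (j * K + g) div K" "(i * K + f) mod K = (j * K + g) mod K" by simp_all
  then show "i = j \<and> f = g" using assms by simp
qed simp

lemma runs_prepare:
  assumes I: "valid_problem I" and s: "has_input I s"
    and zero: "nmem s ''row'' = (\<lambda>_. 0)" "nmem s ''use'' = (\<lambda>_. 0)" "rmem s ''P'' = (\<lambda>_. 0)"
  shows "runs prepare_prog s (Suc (num_jobs I) * (20 + 20) + Suc (num_ops I) * (40 + 20)) (prepared I)"
proof -
  let ?n = "num_jobs I" and ?K = "num_families I" and ?N = "num_ops I"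
  let ?L1 = "For ''j'' (var ''n'') row_body" and ?L2 = "For ''i'' (var ''N'') use_body"
  let ?I1 = "\<lambda>i s'. \<forall>j\<le>i. nmem s' ''row'' j = j * ?K"
  let ?I2 = "\<lambda>i s'. (\<forall>x. 0 < nmem s' ''use'' x \<longleftrightarrow> (\<exists>y<i. job_of I y * ?K + family I y = x)) \<and>
    (\<forall>j. rmem s' ''P'' j = (\<Sum>y | y < i \<and> job_of I y = j. proc_time I y))"
  have 1: "runs ?L1 s (Suc ?n * (20 + 20)) (?I1 ?n)"
  proof (rule runs_For[where Inv = ?I1])
    fix i and s' :: state
    assume i: "nmem s' ''j'' 0 = i" "?I1 i s'" and "unchanged ?L1 s s'"
    then have "nmem s' ''K'' 0 = ?K" using s by (simp add: unchanged_def has_input_def)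
    then show "runs row_body s' 20 (?I1 (Suc i))"
      using i by (intro runs_effect) (auto simp: le_Suc_eq)
  qed (use s zero in \<open>auto simp: unchanged_def has_input_def\<close>)
  have 2: "runs ?L2 s1 (Suc ?N * (40 + 20)) (prepared I)" if s1: "unchanged ?L1 s s1" "?I1 ?n s1" for s1 :: state
  proof -
    have in1: "has_input I s1" by (rule has_input_unchanged[OF s1(1) s]) auto
    have "runs ?L2 s1 (Suc ?N * (40 + 20)) (?I2 ?N)"
    proof (rule runs_For[where Inv = ?I2])
      fix i and s' :: state
      assume i: "i < ?N" "nmem s' ''i'' 0 = i" and inv: "?I2 i s'" and u: "unchanged ?L2 s1 s'"
      then have "has_input I s'" by (intro has_input_unchanged[OF _ in1]) auto
      then have in': "nmem s' ''job'' i = job_of I i" "nmem s' ''family'' i = family I i"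
        "rmem s' ''p'' i = proc_time I i" using i by (auto simp: has_input_def)
      have "job_of I i < ?n" using I i by (simp add: valid_problem_def)
      then have row: "nmem s' ''row'' (job_of I i) = job_of I i * ?K"
        using u s1(2) by (simp add: unchanged_def)
      have "(\<Sum>y | y < Suc i \<and> job_of I y = j. proc_time I y)
        = (\<Sum>y | y < i \<and> job_of I y = j. proc_time I y) + (if job_of I i = j then proc_time I i else 0)" for j
      proof -
        have "{y. y < Suc i \<and> job_of I y = j} = (if job_of I i = j then insert i {y. y < i \<and> job_of I y = j}
          else {y. y < i \<and> job_of I y = j})" by (auto simp: less_Suc_eq)
        then show ?thesis by simp
      qed
      then show "runs use_body s' 40 (?I2 (Suc i))"
        using i inv in' row by (intro runs_effect) (auto simp: less_Suc_eq)
    qed (use s1 in1 zero in \<open>auto simp: unchanged_def has_input_def\<close>)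
    then show ?thesis
    proof (rule runs_mono)
      fix s2
      assume u: "unchanged ?L2 s1 s2" and inv: "?I2 ?N s2"
      have "nmem s2 ''row'' j = j * ?K" if "j < ?n" for j
        using u s1(2) that by (simp add: unchanged_def)
      moreover have "(\<exists>y<?N. job_of I y * ?K + family I y = j * ?K + f) \<longleftrightarrow> f \<in> family I ` ops_of_jobs I {j}"
        if "f < ?K" for j f
      proof -
        have "job_of I y * ?K + family I y = j * ?K + f \<longleftrightarrow> job_of I y = j \<and> family I y = f" if "y < ?N" for y
          using row_index_eq[of "family I y" ?K f] I that \<open>f < ?K\<close> by (auto simp: valid_problem_def)
        then show ?thesis by (auto simp: ops_of_jobs_def)
      qed
      ultimately show "prepared I s2"
        using inv by (simp add: prepared_def ops_of_job_def)
    qed simp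
  qed
  show ?thesis unfolding prepare_prog_def by (rule runs_Seq[OF 1 2])
qed

section \<open>One round of the primal-dual procedure as a program\<close>

abbreviation "is_unplaced x \<equiv> NLess (NRead ''pos'' x) (NConst 1)"

text \<open>Every family is charged to the last unplaced job that uses it; if there is none, its setup time
  goes to the junk cell \<open>n\<close>.\<close>

abbreviation find_body :: com where
  "find_body \<equiv> Cond (BAnd (is_unplaced (var ''j''))
        (NLess (NConst 0) (NRead ''use'' (NAdd (NRead ''row'' (var ''j'')) (var ''f'')))))
      (NWrite ''L'' (NConst 0) (var ''j'')) Skip"

definition find_prog :: com where
  "find_prog = Seq (NWrite ''L'' (NConst 0) (var ''n''))
    (For ''j'' (var ''n'') find_body)"

definition charge_prog :: com where
  "charge_prog =
    Seq (For ''j'' (var ''n'') (RWrite ''a'' (var ''j'') (RRead ''P'' (var ''j''))))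
        (For ''f'' (var ''K'') (Seq find_prog
          (RWrite ''a'' (var ''L'') (RAdd (RRead ''a'' (var ''L'')) (RRead ''s'' (var ''f''))))))"

abbreviation select_body :: com where
  "select_body \<equiv> Cond (is_unplaced (var ''j''))
      (Cond (NLess (var ''k'') (var ''n''))
        (Cond (RLess (RMul (RRead ''w'' (var ''j'')) (RRead ''a'' (var ''k'')))
                     (RMul (RRead ''w'' (var ''k'')) (RRead ''a'' (var ''j''))))
          (NWrite ''k'' (NConst 0) (var ''j'')) Skip)
        (NWrite ''k'' (NConst 0) (var ''j'')))
      Skip"

text \<open>Searches for an unplaced job minimising \<open>w j / a j\<close>. Ratios are compared by
  cross-multiplication because \<open>a\<close> may be 0; \<open>k = n\<close> means that no
  candidate has been seen.\<close>

definition select_prog :: com where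
  "select_prog = Seq (NWrite ''k'' (NConst 0) (var ''n''))
    (For ''j'' (var ''n'') select_body)"

abbreviation reduce_body :: com where
  "reduce_body \<equiv> RWrite ''w'' (var ''j'') (RSub (RRead ''w'' (var ''j''))
            (RMul (RRead ''lam'' (NConst 0)) (RRead ''a'' (var ''j''))))"

text \<open>\<open>lam\<close> is stored first because the loop changes \<open>w\<close> at
  \<open>k\<close>. Weights of placed jobs are changed as well, which is harmless:
  \<open>ordering_inv\<close> constrains residual weights of unplaced jobs only.\<close>

definition reduce_prog :: com where
  "reduce_prog =
    Seq (RWrite ''lam'' (NConst 0) (RDiv (RRead ''w'' (var ''k'')) (RRead ''a'' (var ''k''))))
    (Seq (For ''j'' (var ''n'') reduce_body)
         (NWrite ''pos'' (var ''k'') (NSub (var ''n'') (var ''r''))))"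

lemmas prog_defs = find_prog_def charge_prog_def select_prog_def reduce_prog_def

lemma runs_find:
  assumes s: "has_input I s" "prepared I s" and f: "nmem s ''f'' 0 = f" "f < num_families I"
  shows "runs find_prog s (3 + 4 + Suc (num_jobs I) * (40 + 20)) (\<lambda>s'.
    if f \<in> family I ` ops_of_jobs I (unplaced I (nmem s ''pos''))
    then nmem s' ''L'' 0 \<in> unplaced I (nmem s ''pos'') \<and> f \<in> family I ` ops_of_jobs I {nmem s' ''L'' 0}
    else nmem s' ''L'' 0 = num_jobs I)"
proof -
  let ?n = "num_jobs I" and ?R = "unplaced I (nmem s ''pos'')"
  let ?c1 = "NWrite ''L'' (NConst 0) (var ''n'')"
  let ?L = "For ''j'' (var ''n'') find_body"
  define good where "good j \<longleftrightarrow> j \<in> ?R \<and> f \<in> family I ` ops_of_jobs I {j}" for j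
  let ?Inv = "\<lambda>i s'. (nmem s' ''L'' 0 = ?n \<and> (\<forall>j<i. \<not> good j)) \<or> good (nmem s' ''L'' 0)"
  have 1: "runs ?c1 s 7 (\<lambda>s'. nmem s' ''L'' 0 = ?n)"
    using s by (intro runs_effect) (simp_all add: has_input_def)
  have 2: "runs ?L s1 (Suc ?n * (40 + 20)) (?Inv ?n)"
    if s1: "unchanged ?c1 s s1" "nmem s1 ''L'' 0 = ?n" for s1 :: state
  proof (rule runs_For[where Inv = ?Inv])
    fix i and s' :: state
    assume i: "i < ?n" "nmem s' ''j'' 0 = i" and inv: "?Inv i s'" and u: "unchanged ?L s1 s'"
    have "nmem s' ''pos'' = nmem s ''pos''" "nmem s' ''use'' = nmem s ''use''"
      "nmem s' ''row'' = nmem s ''row''" "nmem s' ''f'' = nmem s ''f''"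
      using u s1(1) by (simp_all add: unchanged_def)
    then have "nmem s' ''pos'' i < 1 \<and> 0 < nmem s' ''use'' (nmem s' ''row'' i + nmem s' ''f'' 0) \<longleftrightarrow> good i"
      using s f i by (auto simp: prepared_def good_def unplaced_def)
    then show "runs find_body s' 40 (?Inv (Suc i))"
      using i inv by (intro runs_effect) (auto simp: less_Suc_eq)
  qed (use s s1 in \<open>auto simp: unchanged_def has_input_def\<close>)
  have "runs find_prog s (7 + Suc ?n * (40 + 20)) (?Inv ?n)"
    unfolding find_prog_def by (rule runs_Seq[OF 1 2])
  then show ?thesis
  proof (rule runs_mono)
    fix s'
    assume inv: "?Inv ?n s'"
    have "f \<in> family I ` ops_of_jobs I ?R \<longleftrightarrow> (\<exists>j<?n. good j)"
      by (auto simp: good_def ops_of_jobs_def unplaced_def)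
    moreover have "j < ?n" if "good j" for j using that by (simp add: good_def unplaced_def)
    ultimately have "if f \<in> family I ` ops_of_jobs I ?R then good (nmem s' ''L'' 0) else nmem s' ''L'' 0 = ?n"
      using inv by auto
    then show "if f \<in> family I ` ops_of_jobs I ?R
      then nmem s' ''L'' 0 \<in> ?R \<and> f \<in> family I ` ops_of_jobs I {nmem s' ''L'' 0}
      else nmem s' ''L'' 0 = ?n"
      by (simp add: good_def split: if_splits)
  qed simp
qed

lemma runs_charge:
  assumes I: "valid_problem I" and s: "has_input I s" "prepared I s"
  shows "runs charge_prog s (Suc (num_jobs I) * (20 + 20) +
      Suc (num_families I) * (7 + Suc (num_jobs I) * 60 + 20 + 20))
    (\<lambda>s'. base I (unplaced I (nmem s ''pos'')) (rmem s' ''a''))"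
proof -
  let ?n = "num_jobs I" and ?K = "num_families I" and ?R = "unplaced I (nmem s ''pos'')"
  let ?P = "\<lambda>j. \<Sum>x\<in>ops_of_job I j. proc_time I x"
  let ?b1 = "RWrite ''a'' (var ''j'') (RRead ''P'' (var ''j''))"
  let ?c = "RWrite ''a'' (var ''L'') (RAdd (RRead ''a'' (var ''L'')) (RRead ''s'' (var ''f'')))"
  let ?L1 = "For ''j'' (var ''n'') ?b1" and ?L2 = "For ''f'' (var ''K'') (Seq find_prog ?c)"
  let ?I1 = "\<lambda>i s'. \<forall>j<i. rmem s' ''a'' j = ?P j"
  define ok where "ok f l \<longleftrightarrow> (if f \<in> family I ` ops_of_jobs I ?R
    then l \<in> ?R \<and> f \<in> family I ` ops_of_jobs I {l} else l = ?n)" for f l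
  \<comment> \<open>The program keeps only the latest choice in \<open>L\<close>; the assignment
    \<open>rep\<close> of all families exists only in the proof, hence the quantifier.\<close>
  let ?I2 = "\<lambda>i s'. \<exists>rep. (\<forall>f<i. ok f (rep f)) \<and>
    (\<forall>j<?n. rmem s' ''a'' j = ?P j + (\<Sum>f | f < i \<and> rep f = j. setup_time I f))"
  have 1: "runs ?L1 s (Suc ?n * (20 + 20)) (?I1 ?n)"
  proof (rule runs_For[where Inv = ?I1])
    fix i and s' :: state
    assume i: "i < ?n" "nmem s' ''j'' 0 = i" "?I1 i s'" and "unchanged ?L1 s s'"
    then have "rmem s' ''P'' i = ?P i" using s by (simp add: unchanged_def prepared_def)
    then show "runs ?b1 s' 20 (?I1 (Suc i))"
      using i by (intro runs_effect) (auto simp: less_Suc_eq)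
  qed (use s in \<open>auto simp: unchanged_def has_input_def\<close>)
  have 2: "runs ?L2 s1 (Suc ?K * (7 + Suc ?n * 60 + 20 + 20)) (?I2 ?K)"
    if s1: "unchanged ?L1 s s1" "?I1 ?n s1" for s1 :: state
  proof (rule runs_For[where Inv = ?I2])
    fix i and s' :: state
    assume i: "i < ?K" "nmem s' ''f'' 0 = i" and inv: "?I2 i s'" and u: "unchanged ?L2 s1 s'"
    have in1: "has_input I s1" "prepared I s1"
      by (rule has_input_unchanged[OF s1(1) s(1)], simp, simp)
         (rule prepared_unchanged[OF s1(1) s(2)], simp, simp)
    have in': "has_input I s'" "prepared I s'"
      by (rule has_input_unchanged[OF u in1(1)], simp add: find_prog_def, simp add: find_prog_def)
         (rule prepared_unchanged[OF u in1(2)], simp add: find_prog_def, simp add: find_prog_def)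
    have pos: "nmem s' ''pos'' = nmem s ''pos''"
      using u s1(1) by (simp add: unchanged_def find_prog_def)
    have find: "runs find_prog s' (7 + Suc ?n * 60) (\<lambda>s''. ok i (nmem s'' ''L'' 0))"
      using runs_find[OF in' i(2,1)] unfolding pos ok_def by simp
    show "runs (Seq find_prog ?c) s' (7 + Suc ?n * 60 + 20) (?I2 (Suc i))"
    proof (rule runs_Seq[OF find])
      fix s2
      assume u2: "unchanged find_prog s' s2" and ok: "ok i (nmem s2 ''L'' 0)"
      let ?l = "nmem s2 ''L'' 0"
      obtain rep where rep: "\<forall>f<i. ok f (rep f)"
        "\<forall>j<?n. rmem s' ''a'' j = ?P j + (\<Sum>f | f < i \<and> rep f = j. setup_time I f)"
        using inv by blast
      have s2: "rmem s2 ''a'' = rmem s' ''a''" "rmem s2 ''s'' i = setup_time I i" "nmem s2 ''f'' 0 = i"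
        using u2 in' i by (auto simp: unchanged_def find_prog_def has_input_def)
      have sum: "(\<Sum>f | f < Suc i \<and> (rep(i := ?l)) f = j. setup_time I f)
        = (\<Sum>f | f < i \<and> rep f = j. setup_time I f) + (if ?l = j then setup_time I i else 0)" for j
      proof -
        have "{f. f < Suc i \<and> (rep(i := ?l)) f = j} =
          (if ?l = j then insert i {f. f < i \<and> rep f = j} else {f. f < i \<and> rep f = j})"
          by (auto simp: less_Suc_eq)
        then show ?thesis by simp
      qed
      show "runs ?c s2 20 (?I2 (Suc i))"
        by (rule runs_effect, simp, simp, rule exI[of _ "rep(i := ?l)"], unfold sum)
          (use rep ok s2 in \<open>auto simp: less_Suc_eq\<close>)
    qed
  qed (use s s1 in \<open>auto simp: unchanged_def has_input_def find_prog_def\<close>)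
  have "runs charge_prog s (Suc ?n * (20 + 20) + Suc ?K * (7 + Suc ?n * 60 + 20 + 20)) (?I2 ?K)"
    unfolding charge_prog_def by (rule runs_Seq[OF 1 2])
  then show ?thesis
  proof (rule runs_mono)
    fix s'
    assume "?I2 ?K s'"
    then obtain rep where rep: "\<forall>f<?K. ok f (rep f)"
      "\<forall>j<?n. rmem s' ''a'' j = ?P j + (\<Sum>f | f < ?K \<and> rep f = j. setup_time I f)" by blast
    show "base I ?R (rmem s' ''a'')"
      by (rule base_charge[where rep = rep]) (use I rep in \<open>auto simp: ok_def unplaced_def\<close>)
  qed simp
qed

text \<open>Transitivity of the cross-multiplied comparison can fail only at
  \<open>y = y' = 0\<close>, a pair that compares equal to every other. The strict inequality
  excludes it.\<close>

lemma select_trans: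
  fixes x y z x' y' z' :: real
  assumes "y * x' \<le> x * y'" "z * y' < y * z'" "0 \<le> x" "0 \<le> x'" "0 \<le> y" "0 \<le> y'" "0 \<le> z" "0 \<le> z'"
  shows "z * x' \<le> x * z'"
proof (cases "y' = 0")
  case True
  then have "x' = 0" using assms by (auto simp: zero_less_mult_iff mult_le_0_iff)
  then show ?thesis using assms by simp
next
  case False
  have "y' * (z * x') \<le> (y * z') * x'" using assms by (simp add: mult_right_mono mult.assoc[symmetric] mult.commute[of y'])
  also have "\<dots> \<le> (x * y') * z'" using mult_right_mono[OF assms(1,8)] by (simp add: ac_simps)
  finally have "y' * (z * x') \<le> y' * (x * z')" by (simp add: ac_simps)
  then show ?thesis using False assms by simp
qed

lemma runs_select:
  assumes s: "has_input I s" and nonempty: "unplaced I (nmem s ''pos'') \<noteq> {}"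
    and nonneg: "\<And>j. j \<in> unplaced I (nmem s ''pos'') \<Longrightarrow> 0 \<le> rmem s ''w'' j \<and> 0 \<le> rmem s ''a'' j"
  shows "runs select_prog s (7 + Suc (num_jobs I) * (60 + 20)) (\<lambda>s'.
    nmem s' ''k'' 0 \<in> unplaced I (nmem s ''pos'') \<and>
    (\<forall>j\<in>unplaced I (nmem s ''pos''). rmem s ''w'' (nmem s' ''k'' 0) * rmem s ''a'' j
      \<le> rmem s ''w'' j * rmem s ''a'' (nmem s' ''k'' 0)))"
proof -
  let ?n = "num_jobs I" and ?R = "unplaced I (nmem s ''pos'')" and ?w = "rmem s ''w''" and ?a = "rmem s ''a''"
  let ?c1 = "NWrite ''k'' (NConst 0) (var ''n'')"
  let ?L = "For ''j'' (var ''n'') select_body"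
  define best where "best i k \<longleftrightarrow> k \<in> ?R \<and> (\<forall>j\<in>?R. j < i \<longrightarrow> ?w k * ?a j \<le> ?w j * ?a k)" for i k
  let ?Inv = "\<lambda>i s'. (nmem s' ''k'' 0 = ?n \<and> (\<forall>j\<in>?R. i \<le> j)) \<or> best i (nmem s' ''k'' 0)"
  have 1: "runs ?c1 s 7 (\<lambda>s'. nmem s' ''k'' 0 = ?n)"
    using s by (intro runs_effect) (simp_all add: has_input_def)
  have 2: "runs ?L s1 (Suc ?n * (60 + 20)) (?Inv ?n)"
    if s1: "unchanged ?c1 s s1" "nmem s1 ''k'' 0 = ?n" for s1 :: state
  proof (rule runs_For[where Inv = ?Inv])
    fix i and s' :: state
    assume i: "i < ?n" "nmem s' ''j'' 0 = i" and inv: "?Inv i s'" and u: "unchanged ?L s1 s'"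
    have s': "nmem s' ''pos'' = nmem s ''pos''" "nmem s' ''n'' 0 = ?n" "rmem s' ''w'' = ?w" "rmem s' ''a'' = ?a"
      using u s1(1) s by (simp_all add: unchanged_def has_input_def)
    let ?k = "nmem s' ''k'' 0"
    \<comment> \<open>This is the value that the body gives to \<open>k\<close>;
      \<open>?k < ?n\<close> fails exactly as long as no unplaced job has been seen.\<close>
    define k' where "k' = (if i \<in> ?R \<and> (?k < ?n \<longrightarrow> ?w i * ?a ?k < ?w ?k * ?a i) then i else ?k)"
    have unpl: "nmem s ''pos'' i = 0 \<longleftrightarrow> i \<in> ?R" using i by (simp add: unplaced_def)
    have k': "(k' = ?n \<and> (\<forall>j\<in>?R. Suc i \<le> j)) \<or> best (Suc i) k'"
    proof (cases "i \<in> ?R")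
      case False
      then have "Suc i \<le> j \<longleftrightarrow> i \<le> j" "j < Suc i \<longleftrightarrow> j < i" if "j \<in> ?R" for j
        using that by (auto simp: less_Suc_eq Suc_le_eq le_less)
      then show ?thesis using inv False by (simp add: k'_def best_def)
    next
      case iR: True
      show ?thesis
      proof (cases "?k < ?n")
        case False
        then have "?k = ?n" "\<forall>j\<in>?R. i \<le> j" using inv by (auto simp: best_def unplaced_def)
        then show ?thesis using iR by (auto simp: k'_def best_def less_Suc_eq)
      next
        case True
        then have b: "best i ?k" using inv by auto
        then have kR: "?k \<in> ?R" by (simp add: best_def)
        show ?thesis
        proof (cases "?w i * ?a ?k < ?w ?k * ?a i")
          case less: True
          have "?w i * ?a j \<le> ?w j * ?a i" if j: "j \<in> ?R" "j < i" for j
          proof (rule select_trans[OF _ less])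
            show "?w ?k * ?a j \<le> ?w j * ?a ?k" using b j by (simp add: best_def)
          qed (use nonneg[OF j(1)] nonneg[OF kR] nonneg[OF iR] in simp_all)
          then show ?thesis using iR less by (auto simp: k'_def best_def less_Suc_eq)
        next
          case False
          then show ?thesis using b True by (auto simp: k'_def best_def less_Suc_eq)
        qed
      qed
    qed
    have "nmem (effect select_body s') ''k'' 0 = k'"
      using i s' unpl by (simp add: k'_def)
    then show "runs select_body s' 60 (?Inv (Suc i))"
      using k' by (intro runs_effect) (simp_all del: effect.simps)
  qed (use s s1 in \<open>auto simp: unchanged_def has_input_def\<close>)
  have "runs select_prog s (7 + Suc ?n * (60 + 20)) (?Inv ?n)"
    unfolding select_prog_def by (rule runs_Seq[OF 1 2])
  then show ?thesis
  proof (rule runs_mono)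
    fix s'
    assume "?Inv ?n s'"
    then show "nmem s' ''k'' 0 \<in> ?R \<and> (\<forall>j\<in>?R. ?w (nmem s' ''k'' 0) * ?a j \<le> ?w j * ?a (nmem s' ''k'' 0))"
    proof
      assume "nmem s' ''k'' 0 = ?n \<and> (\<forall>j\<in>?R. ?n \<le> j)"
      then show ?thesis using nonempty by (auto simp: unplaced_def)
    next
      assume "best ?n (nmem s' ''k'' 0)"
      then show ?thesis by (simp add: best_def unplaced_def)
    qed
  qed simp
qed

lemma runs_reduce:
  assumes s: "has_input I s" "nmem s ''r'' 0 = r"
  defines "k \<equiv> nmem s ''k'' 0"
  shows "runs reduce_prog s (10 + (Suc (num_jobs I) * (20 + 20) + 10)) (\<lambda>s'.
    nmem s' ''pos'' = (nmem s ''pos'')(k := num_jobs I - r) \<and>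
    (\<forall>j<num_jobs I. rmem s' ''w'' j = rmem s ''w'' j - rmem s ''w'' k / rmem s ''a'' k * rmem s ''a'' j))"
proof -
  let ?n = "num_jobs I" and ?w = "rmem s ''w''" and ?a = "rmem s ''a''"
  define lam where "lam = ?w k / ?a k"
  let ?c1 = "RWrite ''lam'' (NConst 0) (RDiv (RRead ''w'' (var ''k'')) (RRead ''a'' (var ''k'')))"
  let ?L = "For ''j'' (var ''n'') reduce_body"
  let ?c2 = "NWrite ''pos'' (var ''k'') (NSub (var ''n'') (var ''r''))"
  let ?Inv = "\<lambda>i s'. (\<forall>j<i. rmem s' ''w'' j = ?w j - lam * ?a j) \<and> (\<forall>j\<ge>i. rmem s' ''w'' j = ?w j)"
  have 1: "runs ?c1 s 10 (\<lambda>s'. rmem s' ''lam'' 0 = lam)"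
    by (intro runs_effect) (simp_all add: lam_def k_def)
  have 2: "runs ?L s1 (Suc ?n * (20 + 20)) (?Inv ?n)"
    if s1: "unchanged ?c1 s s1" "rmem s1 ''lam'' 0 = lam" for s1 :: state
  proof (rule runs_For[where Inv = ?Inv])
    fix i and s' :: state
    assume i: "i < ?n" "nmem s' ''j'' 0 = i" and inv: "?Inv i s'" and u: "unchanged ?L s1 s'"
    have "rmem s' ''a'' = ?a" "rmem s' ''lam'' 0 = lam"
      using u s1 by (simp_all add: unchanged_def)
    then show "runs reduce_body s' 20 (?Inv (Suc i))"
      using i inv by (intro runs_effect) (auto simp: less_Suc_eq)
  qed (use s s1 in \<open>auto simp: unchanged_def has_input_def\<close>)
  have 3: "runs ?c2 s2 10 (\<lambda>s'. nmem s' ''pos'' = (nmem s ''pos'')(k := ?n - r) \<and> ?Inv ?n s')"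
    if u: "unchanged ?c1 s s1" "unchanged ?L s1 s2" and inv: "?Inv ?n s2" for s1 s2 :: state
  proof -
    have "nmem s2 ''n'' 0 = ?n" "nmem s2 ''r'' 0 = r" "nmem s2 ''k'' 0 = k" "nmem s2 ''pos'' = nmem s ''pos''"
      using u s by (simp_all add: unchanged_def k_def has_input_def)
    then show ?thesis using inv by (intro runs_effect) simp_all
  qed
  have "runs reduce_prog s (10 + (Suc ?n * (20 + 20) + 10))
      (\<lambda>s'. nmem s' ''pos'' = (nmem s ''pos'')(k := ?n - r) \<and> ?Inv ?n s')"
    unfolding reduce_prog_def by (rule runs_Seq[OF 1], rule runs_Seq[OF 2], assumption+, rule 3)
  then show ?thesis by (rule runs_mono) (simp_all add: lam_def)
qed

definition round_prog :: com where
  "round_prog = Seq charge_prog (Seq select_prog reduce_prog)"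

lemma vars_round:
  "nvars round_prog = {''j'', ''f'', ''L'', ''k'', ''pos''}" "rvars round_prog = {''a'', ''lam'', ''w''}"
  by (auto simp: round_prog_def prog_defs)

text \<open>Charging the families searches all jobs for each family, which dominates; with one round
  per job this leads to the exponent 3.\<close>

definition round_time :: "problem \<Rightarrow> nat" where
  "round_time I = 300 * (num_jobs I + num_families I + 1)\<^sup>2"

lemma runs_round:
  assumes I: "valid_problem I" and \<pi>: "\<pi> \<in> schedules I" and s: "has_input I s" "prepared I s"
    and r: "nmem s ''r'' 0 = r" "r < num_jobs I"
    and inv: "ordering_inv I \<pi> r (nmem s ''pos'') (rmem s ''w'')"
  shows "runs round_prog s (round_time I) (\<lambda>s'. ordering_inv I \<pi> (Suc r) (nmem s' ''pos'') (rmem s' ''w''))"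
proof -
  let ?n = "num_jobs I" and ?K = "num_families I" and ?R = "unplaced I (nmem s ''pos'')"
  let ?T1 = "Suc ?n * (20 + 20) + Suc ?K * (7 + Suc ?n * 60 + 20 + 20)"
  have 1: "runs charge_prog s ?T1 (\<lambda>s'. base I ?R (rmem s' ''a''))"
    by (rule runs_charge[OF I s])
  have 23: "runs (Seq select_prog reduce_prog) s1 (7 + Suc ?n * (60 + 20) + (10 + (Suc ?n * (20 + 20) + 10)))
    (\<lambda>s'. ordering_inv I \<pi> (Suc r) (nmem s' ''pos'') (rmem s' ''w''))"
    if u1: "unchanged charge_prog s s1" and a: "base I ?R (rmem s1 ''a'')" for s1
  proof -
    have in1: "has_input I s1" by (rule has_input_unchanged[OF u1 s(1)]) (auto simp: prog_defs)
    have s1: "nmem s1 ''pos'' = nmem s ''pos''" "rmem s1 ''w'' = rmem s ''w''" "nmem s1 ''r'' 0 = r"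
      using u1 r by (simp_all add: unchanged_def prog_defs)
    have nonempty: "?R \<noteq> {}" using inv r by (auto simp: ordering_inv_def)
    have nonneg: "0 \<le> rmem s ''w'' j \<and> 0 \<le> rmem s1 ''a'' j" if "j \<in> ?R" for j
      using inv a that by (auto simp: ordering_inv_def base_def)
    have select: "runs select_prog s1 (7 + Suc ?n * (60 + 20)) (\<lambda>s'. nmem s' ''k'' 0 \<in> ?R \<and>
      (\<forall>j\<in>?R. rmem s ''w'' (nmem s' ''k'' 0) * rmem s1 ''a'' j \<le> rmem s ''w'' j * rmem s1 ''a'' (nmem s' ''k'' 0)))"
      using runs_select[OF in1] nonempty nonneg unfolding s1 by blast
    show ?thesis
    proof (rule runs_Seq[OF select])
      fix s2
      assume u2: "unchanged select_prog s1 s2" and k: "nmem s2 ''k'' 0 \<in> ?R \<and>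
        (\<forall>j\<in>?R. rmem s ''w'' (nmem s2 ''k'' 0) * rmem s1 ''a'' j \<le> rmem s ''w'' j * rmem s1 ''a'' (nmem s2 ''k'' 0))"
      have in2: "has_input I s2" by (rule has_input_unchanged[OF u2 in1]) (auto simp: prog_defs)
      have s2: "nmem s2 ''pos'' = nmem s ''pos''" "rmem s2 ''w'' = rmem s ''w''" "nmem s2 ''r'' 0 = r"
        "rmem s2 ''a'' = rmem s1 ''a''"
        using u2 s1 by (simp_all add: unchanged_def prog_defs)
      show "runs reduce_prog s2 (10 + (Suc ?n * (20 + 20) + 10))
        (\<lambda>s'. ordering_inv I \<pi> (Suc r) (nmem s' ''pos'') (rmem s' ''w''))"
      proof (rule runs_mono[OF runs_reduce[OF in2 s2(3)] order_refl])
        fix s'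
        assume s': "nmem s' ''pos'' = (nmem s2 ''pos'')(nmem s2 ''k'' 0 := ?n - r) \<and>
          (\<forall>j<?n. rmem s' ''w'' j = rmem s2 ''w'' j
            - rmem s2 ''w'' (nmem s2 ''k'' 0) / rmem s2 ''a'' (nmem s2 ''k'' 0) * rmem s2 ''a'' j)"
        then have "nmem s' ''pos'' = (nmem s ''pos'')(nmem s2 ''k'' 0 := ?n - r)" using s2 by simp
        then show "ordering_inv I \<pi> (Suc r) (nmem s' ''pos'') (rmem s' ''w'')"
          using ordering_inv_step[OF I \<pi> r(2) inv a, of "nmem s2 ''k'' 0" "rmem s' ''w''"] k s'
          unfolding s2 by (simp add: unplaced_def)
      qed
    qed
  qed
  have "runs round_prog s (?T1 + (7 + Suc ?n * (60 + 20) + (10 + (Suc ?n * (20 + 20) + 10))))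
    (\<lambda>s'. ordering_inv I \<pi> (Suc r) (nmem s' ''pos'') (rmem s' ''w''))"
    unfolding round_prog_def by (rule runs_Seq[OF 1 23])
  then show ?thesis
  proof (rule runs_mono)
    have "Suc ?K * Suc ?n \<le> (?n + ?K + 1)\<^sup>2" "Suc ?n \<le> (?n + ?K + 1)\<^sup>2" "Suc ?K \<le> (?n + ?K + 1)\<^sup>2" "1 \<le> (?n + ?K + 1)\<^sup>2"
      by (simp_all add: power2_eq_square algebra_simps)
    then show "?T1 + (7 + Suc ?n * (60 + 20) + (10 + (Suc ?n * (20 + 20) + 10))) \<le> round_time I"
      unfolding round_time_def by (simp add: algebra_simps)
  qed
qed

section \<open>Batching as a program\<close>

abbreviation batch_body :: com where
  "batch_body \<equiv> Seq
     (NWrite ''o'' (NConst 0) (NRead ''out'' (var ''i''))) (Seq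
     (NWrite ''f'' (NConst 0) (NRead ''family'' (var ''o''))) (Seq
     (Cond (BAnd (NLess (NConst 0) (NRead ''cur'' (var ''f'')))
         (BNot (RLess (RRead ''s'' (var ''f'')) (RAdd (RRead ''y'' (var ''f'')) (RRead ''p'' (var ''o''))))))
       (RWrite ''y'' (var ''f'') (RAdd (RRead ''y'' (var ''f'')) (RRead ''p'' (var ''o''))))
       (Seq (NWrite ''m'' (NConst 0) (NAdd (var ''m'') (NConst 1)))
       (Seq (NWrite ''cur'' (var ''f'') (var ''m''))
            (RWrite ''y'' (var ''f'') (RConst 0)))))
     (NWrite ''key'' (var ''o'') (NRead ''cur'' (var ''f'')))))"

text \<open>The order \<open>q\<close> is read from \<open>out\<close>. The array
  \<open>key\<close>, no longer needed for positions, receives the batch numbers for the second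
  sort.\<close>

definition batch_prog :: com where
  "batch_prog = For ''i'' (var ''N'') batch_body"

lemma runs_batch:
  assumes I: "valid_problem I" and s: "has_input I s"
    and zero: "nmem s ''m'' 0 = 0" "nmem s ''cur'' = (\<lambda>_. 0)" "rmem s ''y'' = (\<lambda>_. 0)"
    and q: "bij_betw (nmem s ''out'') {..<num_ops I} {..<num_ops I}"
  shows "runs batch_prog s (Suc (num_ops I) * (80 + 20)) (\<lambda>s'. \<forall>k<num_ops I.
    nmem s' ''key'' (nmem s ''out'' k) = batch_of I (nmem s ''out'') k)"
proof -
  let ?N = "num_ops I" and ?q = "nmem s ''out''"
  let ?Inv = "\<lambda>i s'. nmem s' ''m'' 0 = batch_count I ?q i \<and> nmem s' ''cur'' = current_batch I ?q i \<and>
    rmem s' ''y'' = batch_fill I ?q i \<and> (\<forall>k<i. nmem s' ''key'' (?q k) = batch_of I ?q k)"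
  have "runs batch_prog s (Suc ?N * (80 + 20)) (?Inv ?N)"
    unfolding batch_prog_def
  proof (rule runs_For[where Inv = ?Inv])
    fix i and s' :: state
    assume i: "i < ?N" "nmem s' ''i'' 0 = i" and inv: "?Inv i s'" and u: "unchanged (For ''i'' (var ''N'') batch_body) s s'"
    have "?q i < ?N" using q i by (auto simp: bij_betw_def)
    then have f: "family I (?q i) < num_families I" using I by (simp add: valid_problem_def)
    have s': "nmem s' ''out'' = ?q" "nmem s' ''family'' (?q i) = family I (?q i)"
      "rmem s' ''p'' (?q i) = proc_time I (?q i)" "rmem s' ''s'' (family I (?q i)) = setup_time I (family I (?q i))"
      using u s \<open>?q i < ?N\<close> f by (simp_all add: unchanged_def has_input_def)
    have inj: "?q k \<noteq> ?q i" if "k < i" for k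
      using q that i by (auto simp: bij_betw_def inj_on_def)
    show "runs batch_body s' 80 (?Inv (Suc i))"
    proof (cases "extends I ?q i")
      case True
      then show ?thesis using i inv s' inj
        by (intro runs_effect) (auto simp: batches_Suc batch_of_eq extends_def All_less_Suc)
    next
      case False
      then show ?thesis using i inv s' inj
        by (intro runs_effect) (auto simp: batches_Suc batch_of_eq extends_def All_less_Suc)
    qed
  qed (use s zero in \<open>auto simp: unchanged_def has_input_def batches_0\<close>)
  then show ?thesis by (rule runs_mono) simp_all
qed

text \<open>The first sort arranges the operations by the positions of their jobs, which gives the
  order for batching; the second arranges them by batches, which gives the output.\<close>

definition schedule_prog :: com where
  "schedule_prog =
    Seq prepare_prog
   (Seq (For ''r'' (var ''n'') round_prog)
   (Seq (For ''i'' (var ''N'') (NWrite ''key'' (var ''i'') (NRead ''pos'' (NRead ''job'' (var ''i'')))))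
   (Seq (NWrite ''M'' (NConst 0) (NAdd (var ''n'') (NConst 1)))
   (Seq sort_prog
   (Seq batch_prog
   (Seq (NWrite ''M'' (NConst 0) (NAdd (var ''N'') (NConst 1)))
        sort_prog))))))"

lemma vars_sort: "nvars sort_prog = {''i'', ''cnt'', ''out''}" "rvars sort_prog = {}"
  by (auto simp: sort_prog_def)

lemma vars_batch: "nvars batch_prog = {''i'', ''o'', ''f'', ''m'', ''cur'', ''key''}" "rvars batch_prog = {''y''}"
  by (auto simp: batch_prog_def)

lemma vars_prepare: "nvars prepare_prog = {''i'', ''j'', ''row'', ''use''}" "rvars prepare_prog = {''P''}"
  by (auto simp: prepare_prog_def)

text \<open>The schedule \<open>\<pi>\<close> occurs only in the analysis and not in the program, so
  the output can be compared with any schedule, in particular with an optimal one.\<close>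

lemma runs_schedule:
  assumes I: "valid_problem I" and \<pi>: "\<pi> \<in> schedules I"
  shows "runs schedule_prog (input_state I)
    (2000 * (num_jobs I + num_families I + 1) ^ 3 + 2000 * num_ops I)
    (\<lambda>s. output_schedule I s \<in> schedules I \<and> total_cost I (output_schedule I s) \<le> 4 * total_cost I \<pi>)"
proof -
  let ?n = "num_jobs I" and ?K = "num_families I" and ?N = "num_ops I"
  define s0 where "s0 = input_state I"
  have in0: "has_input I s0"
    by (auto simp: s0_def input_state_def has_input_def cells_def num_ops_def num_families_def
        job_of_def family_def proc_time_def setup_time_def)
  have w0: "rmem s0 ''w'' j = weight I j" if "j < ?n" for j
    using that by (simp add: s0_def input_state_def cells_def num_jobs_def weight_def)
  have zero: "nmem s0 ''row'' = (\<lambda>_. 0)" "nmem s0 ''use'' = (\<lambda>_. 0)" "rmem s0 ''P'' = (\<lambda>_. 0)"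
    "nmem s0 ''pos'' = (\<lambda>_. 0)" "nmem s0 ''m'' = (\<lambda>_. 0)" "nmem s0 ''cur'' = (\<lambda>_. 0)"
    "rmem s0 ''y'' = (\<lambda>_. 0)"
    by (simp_all add: s0_def input_state_def)

  obtain t1 s1 where 1: "exec prepare_prog s0 t1 s1"
      "t1 \<le> Suc ?n * (20 + 20) + Suc ?N * (40 + 20)" "prepared I s1"
    and u1: "unchanged prepare_prog s0 s1"
    using runs_prepare[OF I in0 zero(1-3)] unfolding runs_def by blast
  have in1: "has_input I s1" by (rule has_input_unchanged[OF u1 in0]) (simp_all add: vars_prepare)

  let ?L2 = "For ''r'' (var ''n'') round_prog"
  let ?Inv = "\<lambda>r s. ordering_inv I \<pi> r (nmem s ''pos'') (rmem s ''w'')"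
  have "runs ?L2 s1 (Suc ?n * (round_time I + 20)) (?Inv ?n)"
  proof (rule runs_For[where Inv = ?Inv])
    fix r and s' :: state
    assume r: "r < ?n" "nmem s' ''r'' 0 = r" and inv: "?Inv r s'" and u: "unchanged ?L2 s1 s'"
    have "has_input I s'" "prepared I s'"
      by (rule has_input_unchanged[OF u in1]; simp add: vars_round)
        (rule prepared_unchanged[OF u 1(3)]; simp add: vars_round)
    then show "runs round_prog s' (round_time I) (?Inv (Suc r))"
      by (rule runs_round[OF I \<pi> _ _ r(2,1) inv])
  next
    show "?Inv 0 s1"
      by (rule ordering_inv_init[OF I])
        (use u1 zero w0 in \<open>simp_all add: unchanged_def vars_prepare\<close>)
  qed (use in1 in \<open>simp_all add: unchanged_def vars_round has_input_def\<close>)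
  then obtain t2 s2 where 2: "exec ?L2 s1 t2 s2" "t2 \<le> Suc ?n * (round_time I + 20)" "?Inv ?n s2"
    and u2: "unchanged ?L2 s1 s2"
    unfolding runs_def by blast
  define pos where "pos = nmem s2 ''pos''"
  have in2: "has_input I s2" by (rule has_input_unchanged[OF u2 in1]) (simp_all add: vars_round)
  have pos_le: "pos j \<le> ?n" if "j < ?n" for j
    using 2(3) that unfolding ordering_inv_def pos_def by force
  have order: "(\<Sum>j<?n. weight I j * load I (ops_of_jobs I {i. pos i \<le> pos j})) \<le> 2 * total_cost I \<pi>"
    using ordering_inv_final[OF 2(3)] by (simp add: pos_def)

  let ?b3 = "NWrite ''key'' (var ''i'') (NRead ''pos'' (NRead ''job'' (var ''i'')))"
  let ?L3 = "For ''i'' (var ''N'') ?b3"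
  let ?Key = "\<lambda>i s. \<forall>x<i. nmem s ''key'' x = pos (job_of I x)"
  have "runs ?L3 s2 (Suc ?N * (20 + 20)) (?Key ?N)"
  proof (rule runs_For[where Inv = ?Key])
    fix i and s' :: state
    assume i: "i < ?N" "nmem s' ''i'' 0 = i" and inv: "?Key i s'" and u: "unchanged ?L3 s2 s'"
    have "nmem s' ''job'' i = job_of I i" "nmem s' ''pos'' = pos"
      using u in2 i by (simp_all add: unchanged_def has_input_def pos_def)
    then show "runs ?b3 s' 20 (?Key (Suc i))"
      using i inv by (intro runs_effect) (auto simp: All_less_Suc)
  qed (use in2 in \<open>simp_all add: unchanged_def has_input_def\<close>)
  then obtain t3 s3 where 3: "exec ?L3 s2 t3 s3" "t3 \<le> Suc ?N * (20 + 20)" "?Key ?N s3"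
    and u3: "unchanged ?L3 s2 s3"
    unfolding runs_def by blast
  have in3: "has_input I s3" by (rule has_input_unchanged[OF u3 in2]) simp_all

  \<comment> \<open>Keys must be below \<open>M\<close>: positions are at most \<open>?n\<close>,
    and in the second sort batch numbers are at most \<open>?N\<close>.\<close>
  let ?c4 = "NWrite ''M'' (NConst 0) (NAdd (var ''n'') (NConst 1))"
  have "runs ?c4 s3 10 (\<lambda>s. nmem s ''M'' 0 = Suc ?n)"
    using in3 by (intro runs_effect) (simp_all add: has_input_def)
  then obtain t4 s4 where 4: "exec ?c4 s3 t4 s4" "t4 \<le> 10" "nmem s4 ''M'' 0 = Suc ?n"
    and u4: "unchanged ?c4 s3 s4"
    unfolding runs_def by blast
  have in4: "has_input I s4" by (rule has_input_unchanged[OF u4 in3]) simp_all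
  have key4: "nmem s4 ''key'' x = pos (job_of I x)" if "x < ?N" for x
    using u4 3(3) that by (simp add: unchanged_def)
  have N4: "nmem s4 ''N'' 0 = ?N" using in4 by (simp add: has_input_def)
  have key4_less: "nmem s4 ''key'' x < Suc ?n" if "x < ?N" for x
    using key4[OF that] pos_le[of "job_of I x"] I that by (simp add: valid_problem_def less_Suc_eq_le)

  obtain t5 s5 where 5: "exec sort_prog s4 t5 s5" "t5 \<le> 100 * (?N + Suc ?n + 3)"
    and u5: "unchanged sort_prog s4 s5"
    and q: "bij_betw (nmem s5 ''out'') {..<?N} {..<?N}"
    and sorted5: "\<And>k l. k < l \<Longrightarrow> l < ?N \<Longrightarrow>
      nmem s4 ''key'' (nmem s5 ''out'' k) \<le> nmem s4 ''key'' (nmem s5 ''out'' l)"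
    using runs_sort[OF N4 4(3) key4_less] unfolding runs_def by blast
  have in5: "has_input I s5" by (rule has_input_unchanged[OF u5 in4]) (simp_all add: vars_sort)
  define q where "q = nmem s5 ''out''"
  have bij_q: "bij_betw q {..<?N} {..<?N}" using q by (simp add: q_def)
  have q_less: "q k < ?N" if "k < ?N" for k using bij_q that by (auto simp: bij_betw_def)
  have q_sorted: "pos (job_of I (q k)) \<le> pos (job_of I (q l))" if "k < l" "l < ?N" for k l
    using sorted5[OF that] key4[OF q_less, of k] key4[OF q_less, of l] that by (simp add: q_def)
  \<comment> \<open>Batching needs no initialisation: none of the preceding programs writes these
    arrays.\<close>
  have zero5: "nmem s5 ''m'' 0 = 0" "nmem s5 ''cur'' = (\<lambda>_. 0)" "rmem s5 ''y'' = (\<lambda>_. 0)"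
    using u1 u2 u3 u4 u5 zero by (simp_all add: unchanged_def vars_prepare vars_round vars_sort)

  obtain t6 s6 where 6: "exec batch_prog s5 t6 s6" "t6 \<le> Suc ?N * (80 + 20)"
    and u6: "unchanged batch_prog s5 s6"
    and b: "\<And>k. k < ?N \<Longrightarrow> nmem s6 ''key'' (q k) = batch_of I q k"
    using runs_batch[OF I in5 zero5 q] unfolding runs_def q_def by blast
  have in6: "has_input I s6" by (rule has_input_unchanged[OF u6 in5]) (simp_all add: vars_batch)

  let ?c7 = "NWrite ''M'' (NConst 0) (NAdd (var ''N'') (NConst 1))"
  have "runs ?c7 s6 10 (\<lambda>s. nmem s ''M'' 0 = Suc ?N)"
    using in6 by (intro runs_effect) (simp_all add: has_input_def)
  then obtain t7 s7 where 7: "exec ?c7 s6 t7 s7" "t7 \<le> 10" "nmem s7 ''M'' 0 = Suc ?N"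
    and u7: "unchanged ?c7 s6 s7"
    unfolding runs_def by blast
  define key where "key = nmem s7 ''key''"
  have b7: "key (q k) = batch_of I q k" if "k < ?N" for k
    using u7 b[OF that] by (simp add: unchanged_def key_def)
  have N7: "nmem s7 ''N'' 0 = ?N"
    using has_input_unchanged[OF u7 in6] by (simp add: has_input_def)
  have key7_less: "nmem s7 ''key'' x < Suc ?N" if "x < ?N" for x
  proof -
    from that have "x \<in> q ` {..<?N}" using bij_q by (simp add: bij_betw_def)
    then obtain k where k: "k < ?N" "q k = x" by auto
    then show ?thesis
      using b7[OF k(1)] batch_of_le[OF k(1), of I q] batch_count_le[of I q ?N] by (simp add: key_def)
  qed

  obtain t8 s8 where 8: "exec sort_prog s7 t8 s8" "t8 \<le> 100 * (?N + Suc ?N + 3)"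
    and out: "bij_betw (nmem s8 ''out'') {..<?N} {..<?N}"
    and sorted8: "\<And>k l. k < l \<Longrightarrow> l < ?N \<Longrightarrow> key (nmem s8 ''out'' k) \<le> key (nmem s8 ''out'' l)"
    using runs_sort[OF N7 7(3) key7_less] unfolding runs_def key_def by blast

  let ?\<sigma> = "output_schedule I s8"
  have \<sigma>: "?\<sigma> \<in> schedules I"
    using out by (simp add: schedules_iff output_schedule_def distinct_map bij_betw_def atLeast0LessThan)
  have \<sigma>_sorted: "key (?\<sigma> ! k) \<le> key (?\<sigma> ! l)" if "k < l" "l < ?N" for k l
    using sorted8[OF that] that by (simp add: output_schedule_def)
  have "total_cost I ?\<sigma> \<le> (\<Sum>j<?n. weight I j * (2 * load I (ops_of_jobs I {i. pos i \<le> pos j})))"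
    unfolding total_cost_def
  proof (intro sum_mono mult_left_mono)
    fix j
    show "job_completion I ?\<sigma> j \<le> 2 * load I (ops_of_jobs I {i. pos i \<le> pos j})"
      by (rule job_completion_batched_le[where b = key and q = q and pos = pos, OF I \<sigma> bij_q q_sorted b7 \<sigma>_sorted])
  qed (use I in \<open>simp add: valid_problem_def\<close>)
  also have "\<dots> = 2 * (\<Sum>j<?n. weight I j * load I (ops_of_jobs I {i. pos i \<le> pos j}))"
    by (simp add: sum_distrib_left mult.left_commute)
  finally have cost: "total_cost I ?\<sigma> \<le> 4 * total_cost I \<pi>" using order by simp

  have "exec schedule_prog s0 (t1 + (t2 + (t3 + (t4 + (t5 + (t6 + (t7 + t8))))))) s8"
    unfolding schedule_prog_def
    by (intro exec.Seq[OF 1(1)] exec.Seq[OF 2(1)] exec.Seq[OF 3(1)] exec.Seq[OF 4(1)] exec.Seq[OF 5(1)]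
        exec.Seq[OF 6(1)] exec.Seq[OF 7(1)] 8(1))
  moreover have "t1 + (t2 + (t3 + (t4 + (t5 + (t6 + (t7 + t8))))))
    \<le> 2000 * (?n + ?K + 1) ^ 3 + 2000 * ?N"
  proof -
    define X where "X = (?n + ?K + 1) ^ 3"
    \<comment> \<open>The rounds are the only part whose time is of third degree; the other parts
      are linear.\<close>
    have "Suc ?n * (round_time I + 20) \<le> (?n + ?K + 1) * (320 * (?n + ?K + 1)\<^sup>2)"
      by (intro mult_mono) (simp_all add: round_time_def)
    also have "\<dots> = 320 * X" by (simp add: X_def power3_eq_cube power2_eq_square algebra_simps)
    finally have "t2 \<le> 320 * X" using 2(2) by simp
    moreover have "?n + ?K + 1 \<le> X" unfolding X_def by (rule self_le_power) simp_all
    ultimately show ?thesis unfolding X_def[symmetric]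
      using 1(2) 3(2) 4(2) 5(2) 6(2) 7(2) 8(2) by simp
  qed
  ultimately show ?thesis using \<sigma> cost unfolding s0_def by (intro runsI) auto
qed

section \<open>Comparison with an optimal schedule\<close>

lemma finite_schedules: "finite (schedules I)"
  by (simp add: schedules_def)

lemma schedules_nonempty: "schedules I \<noteq> {}"
  by (simp add: schedules_def)

lemma total_cost_nonneg: "valid_problem I \<Longrightarrow> 0 \<le> total_cost I \<pi>"
  unfolding total_cost_def
  by (intro sum_nonneg mult_nonneg_nonneg job_completion_nonneg) (simp add: valid_problem_def)

theorem theorem3:
  "\<exists>prog. polynomial_time prog \<and> approximates prog (2 * (1 + sqrt 2))"
proof (intro exI conjI)
  show "polynomial_time schedule_prog"
    unfolding polynomial_time_def
  proof (rule exI[of _ 2000], rule exI[of _ 2000], rule exI[of _ 3], intro allI impI)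
    fix I assume "valid_problem I"
    \<comment> \<open>The time bound does not depend on \<open>\<pi>\<close>, so any schedule will
      do.\<close>
    moreover obtain \<pi> where "\<pi> \<in> schedules I" using schedules_nonempty by blast
    ultimately show "\<exists>t s. exec schedule_prog (input_state I) t s \<and>
        t \<le> 2000 * (num_jobs I + num_families I + 1) ^ 3 + 2000 * num_ops I"
      using runs_schedule[of I \<pi>] unfolding runs_def by blast
  qed
  show "approximates schedule_prog (2 * (1 + sqrt 2))"
    unfolding approximates_def
  proof (intro allI impI)
    fix I assume I: "valid_problem I"
    have "opt_cost I \<in> total_cost I ` schedules I"
      unfolding opt_cost_def by (intro Min_in) (simp_all add: finite_schedules schedules_nonempty)
    then obtain \<pi> where \<pi>: "\<pi> \<in> schedules I" "opt_cost I = total_cost I \<pi>" by blast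
    \<comment> \<open>This amounts to \<open>1 \<le> sqrt 2\<close>.\<close>
    have "(4::real) \<le> 2 * (1 + sqrt 2)" by simp
    then have "4 * total_cost I \<pi> \<le> 2 * (1 + sqrt 2) * opt_cost I"
      unfolding \<pi>(2) by (rule mult_right_mono) (rule total_cost_nonneg[OF I])
    then show "\<exists>t s. exec schedule_prog (input_state I) t s \<and> output_schedule I s \<in> schedules I \<and>
        total_cost I (output_schedule I s) \<le> 2 * (1 + sqrt 2) * opt_cost I"
      using runs_schedule[OF I \<pi>(1)] unfolding runs_def by (meson order_trans)
  qed
qed

end
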